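(* Let $\lambda=\{\lambda_n\}_{n=0}^\infty$ be a real sequence from $\ell^1(\mathbb{Z}_+)$ and $w=\{w_n\}_{n=0}^\infty$ be a positive sequence from $\ell^2(\mathbb{Z}_+)$. Let $d\mu$ be the measure of orthogonality for the sequence of polynomials determined by $P_0(x)=1$, $P_1(x)=(x-\lambda_0)/w_0$ and $xP_n(x)=w_{n-1}P_{n-1}(x)+\lambda_nP_n(x)+w_nP_{n+1}(x)$ for $n\in\mathbb{N}$. Then $$\operatorname{supp}(d\mu)\setminus\{0\}=\{z^{-1}:\ \mathcal{G}_J(z)=0\},$$ where the right-hand side is a bounded discrete subset of $\mathbb{R}$ with $0$ as the only accumulation point. Moreover, for $x\in\operatorname{supp}(d\mu)\setminus\{0\}$ one has $$\mu(x)-\mu(x-0)=-x\,\frac{\mathcal{G}_{J^{(1)}}(x^{-1})}{\mathcal{G}_J'(x^{-1})}.$$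
   Context: $\mathbb{Z}_+=\{0,1,2,\dots\}$. The function $\mathfrak{F}$ is defined on sequences $x=\{x_k\}_{k=1}^\infty\subset\mathbb{C}$ with $\sum_k|x_kx_{k+1}|<\infty$ by $$\mathfrak{F}(x)=1+\sum_{m=1}^{\infty}(-1)^m\sum_{k_1=1}^{\infty}\sum_{k_2=k_1+2}^{\infty}\cdots\sum_{k_m=k_{m-1}+2}^{\infty}x_{k_1}x_{k_1+1}x_{k_2}x_{k_2+1}\cdots x_{k_m}x_{k_m+1}$$ (for sequences indexed from $0$ the indices are shifted). $J$ is the symmetric tridiagonal (Jacobi) matrix with diagonal $\lambda_0,\lambda_1,\dots$ and off-diagonal $w_0,w_1,\dots$; $J^{(k)}$ is the Jacobi matrix with diagonal $\{\lambda_{n+k}\}_{n\ge0}$ and off-diagonal $\{w_{n+k}\}_{n\ge0}$. With $\gamma_0=1$, $\gamma_{k+1}=w_k/\gamma_k$, set $\mathcal{F}_J(z)=\mathfrak{F}(\{\gamma_n^2/(\lambda_n-z)\}_{n=0}^\infty)$, $\phi_\lambda(z)=\prod_{n=0}^\infty(1-z\lambda_n)$, and $$\mathcal{G}_J(z)=\phi_\lambda(z)\mathcal{F}_J(z^{-1})\ (z\neq0),\qquad \mathcal{G}_J(0)=1;$$ this is an entire function (at points $z$ with $z^{-1}$ in the range of $\lambda$ it is defined by continuous extension). $\mathcal{G}_{J^{(1)}}$ is defined analogously from the sequences of $J^{(1)}$. The measure of orthogonality $\mu$ is the unique probability Borel measure on $\mathbb{R}$ with $\int P_mP_n\,d\mu=\delta_{mn}$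 for all $m,n\in\mathbb{Z}_+$; $\mu$ also denotes its right-continuous distribution function $\mu(x)=\mu((-\infty,x])$. *)

theory Defs
  imports "HOL-Probability.Probability"
begin

text \<open>
  All sequences are indexed from 0. The iterated sum
  \<open>\<Sum>k\<^sub>1\<ge>a. \<Sum>k\<^sub>2\<ge>k\<^sub>1+2. \<dots> \<Sum>k\<^sub>m\<ge>k\<^sub>m\<^sub>-\<^sub>1+2. x k\<^sub>1 * x (k\<^sub>1+1) * \<dots> * x k\<^sub>m * x (k\<^sub>m+1)\<close>;
  the summation index \<open>j\<close> below is \<open>k\<^sub>1 - a\<close>.
\<close>

fun gap_sum :: "(nat \<Rightarrow> complex) \<Rightarrow> nat \<Rightarrow> nat \<Rightarrow> complex" where
  "gap_sum x 0 a = 1"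
| "gap_sum x (Suc m) a = (\<Sum>j. x (a + j) * x (a + j + 1) * gap_sum x m (a + j + 2))"

text \<open>Only meaningful when \<open>\<Sum>k. \<bar>x k * x (k + 1)\<bar>\<close> converges; the index \<open>m\<close> starts at 1.\<close>

definition frakF :: "(nat \<Rightarrow> complex) \<Rightarrow> complex" where
  "frakF x = 1 + (\<Sum>m. (-1) ^ Suc m * gap_sum x (Suc m) 0)"

fun jacobi_gamma :: "(nat \<Rightarrow> real) \<Rightarrow> nat \<Rightarrow> real" where
  "jacobi_gamma w 0 = 1"
| "jacobi_gamma w (Suc k) = w k / jacobi_gamma w k"

text \<open>
  A Jacobi matrix is given by its diagonal \<open>lam\<close> and off-diagonal \<open>w\<close>.
\<close>

definition jacobi_F :: "(nat \<Rightarrow> real) \<Rightarrow> (nat \<Rightarrow> real) \<Rightarrow> complex \<Rightarrow> complex" where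
  "jacobi_F lam w z =
     frakF (\<lambda>n. complex_of_real ((jacobi_gamma w n)\<^sup>2) / (complex_of_real (lam n) - z))"

definition jacobi_phi :: "(nat \<Rightarrow> real) \<Rightarrow> complex \<Rightarrow> complex" where
  "jacobi_phi lam z = (\<Prod>n. 1 - z * complex_of_real (lam n))"

text \<open>
  For summable \<open>lam\<close> the points \<open>z \<noteq> 0\<close> with \<open>inverse z\<close> in the range of \<open>lam\<close> are isolated;
  there the value is the continuous extension of the product \<open>jacobi_phi * jacobi_F\<close>.
\<close>

definition jacobi_G :: "(nat \<Rightarrow> real) \<Rightarrow> (nat \<Rightarrow> real) \<Rightarrow> complex \<Rightarrow> complex" where
  "jacobi_G lam w z =
     (if z = 0 then 1
      else if inverse z \<in> range (\<lambda>n. complex_of_real (lam n))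
        then Lim (at z) (\<lambda>u. jacobi_phi lam u * jacobi_F lam w (inverse u))
      else jacobi_phi lam z * jacobi_F lam w (inverse z))"

text \<open>The measure is a Borel probability measure on the real line (\<^locale>\<open>real_distribution\<close>).\<close>

definition orthogonality_measure :: "(nat \<Rightarrow> real poly) \<Rightarrow> real measure \<Rightarrow> bool" where
  "orthogonality_measure P \<mu> \<longleftrightarrow>
     real_distribution \<mu> \<and>
     (\<forall>m n. has_bochner_integral \<mu> (\<lambda>x. poly (P m) x * poly (P n) x) (if m = n then 1 else 0))"

definition measure_support :: "real measure \<Rightarrow> real set" where
  "measure_support \<mu> = {x. \<forall>U. open U \<and> x \<in> U \<longrightarrow> emeasure \<mu> U > 0}"

end

theory Submission
  imports Defs "HOL-Complex_Analysis.Complex_Analysis"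
begin

text \<open>
  The functions \<open>G\<^sub>k\<close> attached to the shifted Jacobi matrices form the unique solution of
  \<open>G\<^sub>k = (1 - u \<lambda>\<^sub>k) G\<^sub>k\<^sub>+\<^sub>1 - u\<^sup>2 w\<^sub>k\<^sup>2 G\<^sub>k\<^sub>+\<^sub>2\<close> that tends to 1, and this solution is entire in \<open>u\<close>.
  With \<open>z = 1/u\<close> and \<open>f\<^sub>n = u\<^sup>n\<^sup>+\<^sup>1 w\<^sub>0 \<dots> w\<^sub>n\<^sub>-\<^sub>1 G\<^sub>n\<^sub>+\<^sub>1(u)\<close>, the partial sums
  \<open>S = \<Sum>n\<le>N. f\<^sub>n P\<^sub>n\<close> satisfy \<open>(z - x) S(x) = G\<^sub>0(u) + r(x)\<close> with \<open>r \<rightarrow> 0\<close> in \<open>L\<^sup>2(\<mu>)\<close>, while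
  the \<open>L\<^sup>2\<close> norms of \<open>S\<close> stay bounded. If \<open>G\<^sub>0(u) = 0\<close>, then \<open>S\<close> concentrates near \<open>z\<close>, which is
  therefore real and in the support. If \<open>G\<^sub>0\<close> does not vanish near \<open>1/x\<close>, then intervals of length
  \<open>\<delta>\<close> near \<open>x\<close> have measure \<open>O(\<delta>\<^sup>2)\<close>, so the distribution function has derivative 0 there and \<open>x\<close> is
  not in the support. For nonreal \<open>z\<close>, integrating the identity gives
  \<open>f\<^sub>0 = G\<^sub>0(u) \<integral> d\<mu>(x) / (z - x)\<close>, and the jump at a zero is read off by letting \<open>z\<close> approach it
  vertically.
\<close>

subsection \<open>Three-term recurrences with summable coefficients\<close>

text \<open>
  Backward solution, evaluated at \<open>k\<close>, of \<open>y\<^sub>k = a\<^sub>k y\<^sub>k\<^sub>+\<^sub>1 - b\<^sub>k y\<^sub>k\<^sub>+\<^sub>2\<close> with value 1 at the indices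
  \<open>k + n - 1\<close> and \<open>k + n\<close>; \<open>rec_sol\<close> is its limit as \<open>n \<rightarrow> \<infinity>\<close>, written as a telescoping series.
\<close>

fun trunc_rec :: "(nat \<Rightarrow> complex) \<Rightarrow> (nat \<Rightarrow> complex) \<Rightarrow> nat \<Rightarrow> nat \<Rightarrow> complex" where
  "trunc_rec a b k 0 = 1"
| "trunc_rec a b k (Suc 0) = 1"
| "trunc_rec a b k (Suc (Suc n)) =
     a k * trunc_rec a b (Suc k) (Suc n) - b k * trunc_rec a b (Suc (Suc k)) n"

definition rec_sol :: "(nat \<Rightarrow> complex) \<Rightarrow> (nat \<Rightarrow> complex) \<Rightarrow> nat \<Rightarrow> complex" where
  "rec_sol a b k = 1 + (\<Sum>n. trunc_rec a b k (Suc n) - trunc_rec a b k n)"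

text \<open>One step costs at most the factor \<open>1 + e <= exp e\<close>. Exponentials are chosen
  because the factors of successive steps then combine into the exponential of a sum.\<close>

lemma norm_rec_step_le:
  fixes a b x y :: complex
  assumes "norm (a - 1) + norm b \<le> e" "norm x \<le> M" "norm y \<le> M"
  shows "norm (a * x - b * y) \<le> exp e * M"
proof -
  have M: "M \<ge> 0" using assms(2) norm_ge_zero order_trans by blast
  have "a * x - b * y = x + (a - 1) * x - b * y" by (simp add: algebra_simps)
  then have "norm (a * x - b * y) \<le> norm x + norm ((a - 1) * x) + norm (b * y)"
    using norm_triangle_ineq4[of "x + (a - 1) * x" "b * y"] norm_triangle_ineq[of x "(a - 1) * x"]
    by simp
  also have "\<dots> \<le> M + norm (a - 1) * M + norm b * M"
    using assms M by (intro add_mono) (auto simp: norm_mult intro: mult_left_mono)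
  also have "\<dots> = (1 + (norm (a - 1) + norm b)) * M" by (simp add: algebra_simps)
  also have "\<dots> \<le> exp e * M"
    using M assms(1) by (intro mult_right_mono order_trans[OF _ exp_ge_add_one_self]) auto
  finally show ?thesis .
qed

text \<open>The recurrence is a summable perturbation of the one with \<open>a = 1\<close>,
  \<open>b = 0\<close>. The majorant \<open>e\<close> is a separate parameter so that one
  \<open>e\<close> can serve a whole family of coefficients.\<close>

locale summable_rec =
  fixes a b :: "nat \<Rightarrow> complex" and e :: "nat \<Rightarrow> real"
  assumes coeff_le: "\<And>k. norm (a k - 1) + norm (b k) \<le> e k"
    and summable_e: "summable e"
begin

lemma e_nonneg: "e k \<ge> 0"
  using coeff_le[of k] norm_ge_zero[of "a k - 1"] norm_ge_zero[of "b k"] by linarith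

lemma sum_e_le: "finite A \<Longrightarrow> (\<Sum>j\<in>A. e j) \<le> suminf e"
  by (rule sum_le_suminf[OF summable_e]) (auto simp: e_nonneg)

lemma norm_trunc_rec_le: "norm (trunc_rec a b k n) \<le> exp (\<Sum>j=k..<k+n. e j)"
proof (induction n arbitrary: k rule: induct_nat_012)
  case (ge2 n)
  \<comment> \<open>The two values on the right use windows of different length; the shorter window
    is enlarged so that both share one bound.\<close>
  have "(\<Sum>j=Suc (Suc k)..<Suc (Suc k)+n. e j) \<le> (\<Sum>j=Suc k..<Suc k + Suc n. e j)"
    by (intro sum_mono2) (auto simp: e_nonneg)
  then have "norm (trunc_rec a b (Suc (Suc k)) n) \<le> exp (\<Sum>j=Suc k..<Suc k + Suc n. e j)"
    by (rule order_trans[OF ge2(1) iffD2[OF exp_le_cancel_iff]])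
  from norm_rec_step_le[OF coeff_le ge2(2) this, of k]
  show ?case by (simp add: mult_exp_exp sum.atLeast_Suc_lessThan[of k] del: sum.op_ivl_Suc)
qed (auto simp: e_nonneg)

text \<open>Differences of consecutive truncations obey the same linear recurrence, which preserves
  \<open>k + n\<close>. The descent ends at \<open>n = 1\<close> with \<open>(a j - 1) - b j\<close>
  for \<open>j = k + n - 1\<close>, or at \<open>n = 0\<close> with difference 0, where the
  truncated subtraction is harmless.\<close>

lemma norm_trunc_rec_diff_le:
  "norm (trunc_rec a b k (Suc n) - trunc_rec a b k n) \<le> exp (\<Sum>j=k..<k+n. e j) * e (k + n - 1)"
proof (induction n arbitrary: k rule: induct_nat_012)
  case 1
  have "trunc_rec a b k (Suc (Suc 0)) - trunc_rec a b k (Suc 0) = (a k - 1) - b k"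
    by simp
  then have "norm (trunc_rec a b k (Suc (Suc 0)) - trunc_rec a b k (Suc 0)) \<le> e k"
    by (simp only: order_trans[OF norm_triangle_ineq4 coeff_le])
  also have "e k \<le> exp (e k) * e k"
    using mult_right_mono[of 1 "exp (e k)" "e k"] e_nonneg[of k] by simp
  finally show ?case by simp
next
  case (ge2 n)
  define M where "M = exp (\<Sum>j=Suc k..<Suc k + Suc n. e j) * e (k + Suc n)"
  have 1: "norm (trunc_rec a b (Suc k) (Suc (Suc n)) - trunc_rec a b (Suc k) (Suc n)) \<le> M"
    using ge2(2)[of "Suc k"] by (simp add: M_def)
  have "(\<Sum>j=Suc (Suc k)..<Suc (Suc k)+n. e j) \<le> (\<Sum>j=Suc k..<Suc k + Suc n. e j)"
    by (intro sum_mono2) (auto simp: e_nonneg)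
  then have "exp (\<Sum>j=Suc (Suc k)..<Suc (Suc k)+n. e j) * e (k + Suc n) \<le> M"
    unfolding M_def by (intro mult_right_mono) (auto simp: e_nonneg)
  then have 2: "norm (trunc_rec a b (Suc (Suc k)) (Suc n) - trunc_rec a b (Suc (Suc k)) n) \<le> M"
    using ge2(1)[of "Suc (Suc k)"] by simp
  have "trunc_rec a b k (Suc (Suc (Suc n))) - trunc_rec a b k (Suc (Suc n))
     = a k * (trunc_rec a b (Suc k) (Suc (Suc n)) - trunc_rec a b (Suc k) (Suc n))
       - b k * (trunc_rec a b (Suc (Suc k)) (Suc n) - trunc_rec a b (Suc (Suc k)) n)"
    by (simp add: algebra_simps)
  also have "norm \<dots> \<le> exp (e k) * M"
    by (rule norm_rec_step_le[OF coeff_le 1 2])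
  also have "\<dots> = exp (\<Sum>j=k..<k + Suc (Suc n). e j) * e (k + Suc (Suc n) - 1)"
    by (simp add: M_def mult_exp_exp sum.atLeast_Suc_lessThan[of k] del: sum.op_ivl_Suc)
  finally show ?case .
qed (auto simp: e_nonneg)

lemma norm_trunc_rec_le': "norm (trunc_rec a b k n) \<le> exp (suminf e)"
  by (rule order_trans[OF norm_trunc_rec_le iffD2[OF exp_le_cancel_iff]]) (simp add: sum_e_le)

lemma norm_trunc_rec_diff_le':
  "norm (trunc_rec a b k (Suc n) - trunc_rec a b k n) \<le> exp (suminf e) * e (k + n - 1)"
  by (rule order_trans[OF norm_trunc_rec_diff_le mult_right_mono])
     (use sum_e_le[of "{k..<k+n}"] e_nonneg in auto)

lemma summable_e_shift: "summable (\<lambda>n. e (k + n - 1))"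
proof -
  have "summable (\<lambda>n. e (n + k))" using summable_e by (simp add: summable_iff_shift)
  then have "summable (\<lambda>n. e (k + Suc n - 1))" by (simp add: add.commute)
  then show ?thesis by (subst (asm) summable_Suc_iff)
qed

lemma summable_trunc_rec_diff:
  "summable (\<lambda>n. norm (trunc_rec a b k (Suc n) - trunc_rec a b k n))"
  by (rule summable_comparison_test'[of "\<lambda>n. exp (suminf e) * e (k + n - 1)" 0])
     (use norm_trunc_rec_diff_le' summable_e_shift in \<open>auto intro: summable_mult\<close>)

lemma trunc_rec_tendsto: "(\<lambda>n. trunc_rec a b k n) \<longlonglongrightarrow> rec_sol a b k"
proof -
  have "(\<lambda>n. 1 + (\<Sum>i<n. trunc_rec a b k (Suc i) - trunc_rec a b k i)) \<longlonglongrightarrow> rec_sol a b k"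
    unfolding rec_sol_def
    by (intro tendsto_intros summable_LIMSEQ summable_norm_cancel[OF summable_trunc_rec_diff])
  then show ?thesis
    by (simp add: sum_lessThan_telescope)
qed

lemma norm_rec_sol_le: "norm (rec_sol a b k) \<le> exp (suminf e)"
  by (rule LIMSEQ_le_const2[OF tendsto_norm[OF trunc_rec_tendsto]])
     (use norm_trunc_rec_le' in auto)

lemma rec_sol_rec: "rec_sol a b k = a k * rec_sol a b (Suc k) - b k * rec_sol a b (Suc (Suc k))"
proof (rule LIMSEQ_unique)
  show "(\<lambda>n. trunc_rec a b k (Suc (Suc n))) \<longlonglongrightarrow> rec_sol a b k"
    by (intro LIMSEQ_Suc trunc_rec_tendsto)
  show "(\<lambda>n. trunc_rec a b k (Suc (Suc n)))
      \<longlonglongrightarrow> a k * rec_sol a b (Suc k) - b k * rec_sol a b (Suc (Suc k))"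
    unfolding trunc_rec.simps by (intro tendsto_intros LIMSEQ_Suc trunc_rec_tendsto)
qed

lemma rec_sol_tendsto_1: "rec_sol a b \<longlonglongrightarrow> 1"
proof -
  \<comment> \<open>Stated at \<open>Suc k\<close> because \<open>Suc k + n - 1\<close> is then
    \<open>n + k\<close>, so the right-hand side is a tail of the series of
    \<open>e\<close>.\<close>
  have bound: "norm (rec_sol a b (Suc k) - 1) \<le> exp (suminf e) * (suminf e - sum e {..<k})" for k
  proof -
    have s: "summable (\<lambda>n. e (n + k))" using summable_e by (simp add: summable_iff_shift)
    have "norm (rec_sol a b (Suc k) - 1)
       \<le> (\<Sum>n. norm (trunc_rec a b (Suc k) (Suc n) - trunc_rec a b (Suc k) n))"
      unfolding rec_sol_def using summable_norm[OF summable_trunc_rec_diff] by simp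
    also have "\<dots> \<le> (\<Sum>n. exp (suminf e) * e (n + k))"
      using norm_trunc_rec_diff_le'[of "Suc k"] s
      by (intro suminf_le summable_trunc_rec_diff summable_mult) (simp_all add: add.commute)
    also have "\<dots> = exp (suminf e) * (suminf e - sum e {..<k})"
      using s suminf_minus_initial_segment[OF summable_e, of k] by (simp add: suminf_mult)
    finally show ?thesis .
  qed
  have "(\<lambda>k. exp (suminf e) * (suminf e - sum e {..<k})) \<longlonglongrightarrow> exp (suminf e) * (suminf e - suminf e)"
    by (intro tendsto_intros summable_LIMSEQ summable_e)
  then have "(\<lambda>k. exp (suminf e) * (suminf e - sum e {..<k})) \<longlonglongrightarrow> 0"
    by simp
  then have "(\<lambda>k. rec_sol a b (Suc k) - 1) \<longlonglongrightarrow> 0"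
    by (rule Lim_null_comparison[OF always_eventually[OF allI[OF bound]]])
  then have "(\<lambda>k. rec_sol a b (Suc k)) \<longlonglongrightarrow> 1"
    by (rule LIM_zero_cancel)
  then show ?thesis by (rule LIMSEQ_imp_Suc)
qed

text \<open>Any solution is controlled by two neighbouring values far out, with a factor that stays
  below \<open>exp (suminf e)\<close>. This makes the behaviour at infinity decisive.\<close>

lemma norm_rec_le:
  assumes rec: "\<And>k. d k = a k * d (Suc k) - b k * d (Suc (Suc k))"
    and "norm (d (k + n)) \<le> M" "norm (d (Suc (k + n))) \<le> M"
  shows "norm (d k) \<le> exp (\<Sum>j=k..<k+n. e j) * M"
  using assms(2,3)
proof (induction n arbitrary: k rule: induct_nat_012)
  case 1
  show ?case using norm_rec_step_le[OF coeff_le, of "d (Suc k)" M "d (Suc (Suc k))" k] 1 rec[of k] by simp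
next
  case (ge2 n)
  have M: "M \<ge> 0" using ge2(3) norm_ge_zero order_trans by blast
  have 1: "norm (d (Suc k)) \<le> exp (\<Sum>j=Suc k..<Suc k + Suc n. e j) * M"
    by (rule ge2(2)) (use ge2(3,4) in simp_all)
  have "(\<Sum>j=Suc (Suc k)..<Suc (Suc k)+n. e j) \<le> (\<Sum>j=Suc k..<Suc k + Suc n. e j)"
    by (intro sum_mono2) (auto simp: e_nonneg)
  then have "exp (\<Sum>j=Suc (Suc k)..<Suc (Suc k)+n. e j) * M \<le> exp (\<Sum>j=Suc k..<Suc k + Suc n. e j) * M"
    using M by (intro mult_right_mono) auto
  moreover have "norm (d (Suc (Suc k))) \<le> exp (\<Sum>j=Suc (Suc k)..<Suc (Suc k)+n. e j) * M"
    by (rule ge2(1)) (use ge2(3,4) in simp_all)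
  ultimately have 2: "norm (d (Suc (Suc k))) \<le> exp (\<Sum>j=Suc k..<Suc k + Suc n. e j) * M"
    by linarith
  show ?case
    using norm_rec_step_le[OF coeff_le 1 2, of k] rec[of k]
    by (simp add: mult_exp_exp sum.atLeast_Suc_lessThan[of k] mult.assoc[symmetric] del: sum.op_ivl_Suc)
qed auto

lemma rec_eq_0:
  assumes rec: "\<And>k. d k = a k * d (Suc k) - b k * d (Suc (Suc k))"
    and lim: "d \<longlonglongrightarrow> 0"
  shows "d k = 0"
proof -
  have "norm (d k) \<le> 0 + r" if "r > 0" for r
  proof -
    \<comment> \<open>Transport back from infinity costs at most \<open>exp (suminf e)\<close>,
      which turns \<open>M\<close> into \<open>r\<close>.\<close>
    define M where "M = r / exp (suminf e)"
    have M: "M > 0" using that by (simp add: M_def)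
    obtain N where N: "\<And>n. n \<ge> N \<Longrightarrow> norm (d n) < M"
      using LIMSEQ_D[OF lim M] by auto
    have "norm (d k) \<le> exp (\<Sum>j=k..<k+N. e j) * M"
      by (rule norm_rec_le[OF rec]) (use N[of "k+N"] N[of "Suc (k+N)"] in auto)
    also have "\<dots> \<le> exp (suminf e) * M"
      using M sum_e_le[of "{k..<k+N}"] by (intro mult_right_mono) auto
    finally show ?thesis by (simp add: M_def)
  qed
  then have "norm (d k) \<le> 0" by (rule field_le_epsilon)
  then show ?thesis by simp
qed

text \<open>The difference of two solutions tending to 1 is a solution tending to 0. Later
  identifications thus reduce to checking a recurrence and a limit.\<close>

lemma rec_sol_unique:
  assumes rec: "\<And>k. y k = a k * y (Suc k) - b k * y (Suc (Suc k))"
    and lim: "y \<longlonglongrightarrow> 1"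
  shows "y k = rec_sol a b k"
proof -
  have "y k - rec_sol a b k = 0"
  proof (rule rec_eq_0)
    show "(\<lambda>k. y k - rec_sol a b k) \<longlonglongrightarrow> 0"
      using tendsto_diff[OF lim rec_sol_tendsto_1] by simp
    show "y k - rec_sol a b k = a k * (y (Suc k) - rec_sol a b (Suc k))
        - b k * (y (Suc (Suc k)) - rec_sol a b (Suc (Suc k)))" for k
      by (subst rec, subst rec_sol_rec) (simp add: algebra_simps)
  qed
  then show ?thesis by simp
qed

end

section \<open>Holomorphic dependence on a parameter\<close>

lemma holomorphic_on_trunc_rec [holomorphic_intros]:
  assumes "\<And>k. (\<lambda>u. a u k) holomorphic_on S" "\<And>k. (\<lambda>u. b u k) holomorphic_on S"
  shows "(\<lambda>u. trunc_rec (a u) (b u) k n) holomorphic_on S"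
proof (induction n arbitrary: k rule: induct_nat_012)
  case (ge2 n)
  show ?case unfolding trunc_rec.simps
    by (intro holomorphic_on_diff holomorphic_on_mult assms ge2)
qed auto

text \<open>Since \<open>e\<close> does not depend on \<open>u\<close>, the telescoping series
  converges uniformly on \<open>S\<close> by the Weierstrass test, and its partial sums are
  holomorphic.\<close>

lemma holomorphic_on_rec_sol:
  assumes S: "open S"
    and a: "\<And>k. (\<lambda>u. a u k) holomorphic_on S"
    and b: "\<And>k. (\<lambda>u. b u k) holomorphic_on S"
    and e: "\<And>u. u \<in> S \<Longrightarrow> summable_rec (a u) (b u) e"
  shows "(\<lambda>u. rec_sol (a u) (b u) k) holomorphic_on S"
\<comment> \<open>A point of \<open>S\<close> is needed to extract the summability of
  \<open>e\<close> from the hypothesis.\<close>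
proof (cases "S = {}")
  case False
  then obtain u0 where "u0 \<in> S" by auto
  interpret s0: summable_rec "a u0" "b u0" e by (rule e) fact
  define g where "g = (\<lambda>i u. trunc_rec (a u) (b u) k (Suc i) - trunc_rec (a u) (b u) k i)"
  have "uniform_limit S (\<lambda>n u. \<Sum>i<n. g i u) (\<lambda>u. suminf (\<lambda>i. g i u)) sequentially"
  proof (rule Weierstrass_m_test)
    show "norm (g i u) \<le> exp (suminf e) * e (k + i - 1)" if "u \<in> S" for i u
      unfolding g_def by (rule summable_rec.norm_trunc_rec_diff_le'[OF e[OF that]])
    show "summable (\<lambda>i. exp (suminf e) * e (k + i - 1))"
      by (intro summable_mult s0.summable_e_shift)
  qed
  then have lim: "uniform_limit S (\<lambda>n u. \<Sum>i<n. g i u) (\<lambda>u. rec_sol (a u) (b u) k - 1) sequentially"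
    by (simp add: rec_sol_def g_def)
  have "(\<lambda>u. rec_sol (a u) (b u) k - 1) holomorphic_on S"
  proof (rule holomorphic_uniform_sequence[OF S])
    show "(\<lambda>u. \<Sum>i<n. g i u) holomorphic_on S" for n
      unfolding g_def by (intro holomorphic_intros a b)
    show "\<exists>d>0. cball x d \<subseteq> S \<and>
        uniform_limit (cball x d) (\<lambda>n u. \<Sum>i<n. g i u) (\<lambda>u. rec_sol (a u) (b u) k - 1) sequentially"
      if "x \<in> S" for x
    proof -
      obtain d where "d > 0" "cball x d \<subseteq> S"
        using S \<open>x \<in> S\<close> open_contains_cball by blast
      then show ?thesis using uniform_limit_on_subset[OF lim] by blast
    qed
  qed
  from holomorphic_on_add[OF this holomorphic_on_const[of 1]] show ?thesis
    by (simp only: diff_add_cancel)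
qed (simp add: holomorphic_on_def)

subsection \<open>The entire function of a Jacobi matrix\<close>

locale summable_adjacent =
  fixes x :: "nat \<Rightarrow> complex"
  assumes summable_adjacent: "summable (\<lambda>n. norm (x n * x (n + 1)))"
begin

definition tail :: "nat \<Rightarrow> real" where
  "tail k = (\<Sum>j. norm (x (k + j) * x (k + j + 1)))"

text \<open>This is \<open>frakF\<close> of the sequence shifted by \<open>k\<close>, with the
  leading 1 absorbed as the term \<open>m = 0\<close>.\<close>

definition alt_gap :: "nat \<Rightarrow> complex" where
  "alt_gap k = (\<Sum>m. (-1) ^ m * gap_sum x m k)"

lemma summable_shift: "summable (\<lambda>j. norm (x (k + j) * x (k + j + 1)))"
  using summable_ignore_initial_segment[OF summable_adjacent, of k] by (simp add: add.commute)

lemma tail_nonneg: "tail k \<ge> 0"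
  unfolding tail_def by (intro suminf_nonneg summable_shift) auto

lemma tail_eq: "tail k = suminf (\<lambda>n. norm (x n * x (n + 1))) - (\<Sum>n<k. norm (x n * x (n + 1)))"
  using suminf_minus_initial_segment[OF summable_adjacent, of k] by (simp add: tail_def add.commute)

lemma tail_antimono: "j \<le> k \<Longrightarrow> tail k \<le> tail j"
  unfolding tail_eq by (intro diff_left_mono sum_mono2) auto

lemma tail_tendsto: "tail \<longlonglongrightarrow> 0"
proof -
  have "tail \<longlonglongrightarrow> suminf (\<lambda>n. norm (x n * x (n + 1))) - suminf (\<lambda>n. norm (x n * x (n + 1)))"
    unfolding tail_eq[abs_def] by (intro tendsto_intros summable_LIMSEQ summable_adjacent)
  then show ?thesis by simp
qed

text \<open>The two claims need each other: the bound for \<open>Suc m\<close> uses summability at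
  level \<open>m\<close>, and summability at level \<open>Suc m\<close> uses the new bound. Inner
  sums start later, so their tails are at most \<open>tail k\<close>.\<close>

lemma norm_gap_sum_le_and_summable:
  "norm (gap_sum x m k) \<le> tail k ^ m \<and>
   summable (\<lambda>j. norm (x (k + j) * x (k + j + 1) * gap_sum x m (k + j + 2)))"
proof (induction m arbitrary: k)
  case 0
  show ?case using summable_shift[of k] by simp
next
  case (Suc m)
  have bound: "norm (x (k + j) * x (k + j + 1) * gap_sum x n (k + j + 2))
      \<le> norm (x (k + j) * x (k + j + 1)) * tail k ^ n"
    if "\<And>k. norm (gap_sum x n k) \<le> tail k ^ n" for n k j
    unfolding norm_mult[of _ "gap_sum x n (k + j + 2)"]
    by (intro mult_left_mono order_trans[OF that] power_mono tail_antimono tail_nonneg) auto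
  have le: "norm (gap_sum x (Suc m) k) \<le> tail k ^ Suc m" for k
  proof -
    have "norm (gap_sum x (Suc m) k)
        \<le> (\<Sum>j. norm (x (k + j) * x (k + j + 1) * gap_sum x m (k + j + 2)))"
      unfolding gap_sum.simps by (rule summable_norm) (use Suc in auto)
    also have "\<dots> \<le> (\<Sum>j. norm (x (k + j) * x (k + j + 1)) * tail k ^ m)"
      using Suc bound[of m k] by (intro suminf_le summable_mult2 summable_shift) auto
    also have "\<dots> = tail k * tail k ^ m"
      unfolding tail_def by (rule suminf_mult2[OF summable_shift, symmetric])
    finally show ?thesis by simp
  qed
  have "summable (\<lambda>j. norm (x (k + j) * x (k + j + 1) * gap_sum x (Suc m) (k + j + 2)))"
    by (rule summable_comparison_test'[OF summable_mult2[OF summable_shift[of k], of "tail k ^ Suc m"]])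
       (use bound[OF le, of k] in \<open>simp del: gap_sum.simps\<close>)
  with le show ?case by blast
qed

lemmas norm_gap_sum_le = norm_gap_sum_le_and_summable[THEN conjunct1]

text \<open>The cases are that the first chosen index equals \<open>k\<close> or is larger.\<close>

lemma gap_sum_rec:
  "gap_sum x (Suc m) k = x k * x (k + 1) * gap_sum x m (k + 2) + gap_sum x (Suc m) (Suc k)"
proof -
  have "summable (\<lambda>j. x (k + j) * x (k + j + 1) * gap_sum x m (k + j + 2))"
    by (rule summable_norm_cancel[OF norm_gap_sum_le_and_summable[THEN conjunct2]])
  from suminf_split_head[OF this] show ?thesis by simp
qed

lemma summable_geometric_tail: "tail k < 1 \<Longrightarrow> summable (\<lambda>m. norm (gap_sum x m k))"
  by (rule summable_comparison_test'[OF summable_geometric[of "tail k"]])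
     (use norm_gap_sum_le tail_nonneg in auto)

text \<open>The geometric bound works only where \<open>tail k < 1\<close>, that is, far out;
  \<open>gap_sum_rec\<close> carries summability down to the smaller indices.\<close>

lemma summable_gap_sum: "summable (\<lambda>m. norm (gap_sum x m k))"
proof -
  obtain N where N: "\<And>n. n \<ge> N \<Longrightarrow> tail n < 1"
    using order_tendstoD(2)[OF tail_tendsto, of 1] by (auto simp: eventually_sequentially)
  \<comment> \<open>Descending induction: \<open>i\<close> counts the steps below \<open>N\<close>,
    and \<open>i = N\<close> reaches every index.\<close>
  have "\<forall>j\<ge>N - i. summable (\<lambda>m. norm (gap_sum x m j))" for i
  proof (induction i)
    case 0
    show ?case using N summable_geometric_tail by simp
  next
    case (Suc i)
    have "summable (\<lambda>m. norm (gap_sum x m j))" if j: "j \<ge> N - Suc i" for j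
    proof (cases "j \<ge> N - i")
      case False
      then have 1: "Suc j \<ge> N - i" "j + 2 \<ge> N - i" using j by auto
      have "summable (\<lambda>m. norm (x j * x (j + 1)) * norm (gap_sum x m (j + 2)) + norm (gap_sum x (Suc m) (Suc j)))"
        using Suc 1 by (intro summable_add summable_mult iffD2[OF summable_Suc_iff]) blast+
      then have "summable (\<lambda>m. norm (gap_sum x (Suc m) j))"
        by (rule summable_comparison_test'[where N = 0])
           (unfold real_norm_def abs_norm_cancel norm_mult[symmetric], subst gap_sum_rec,
            rule norm_triangle_ineq)
      then show ?thesis by (rule iffD1[OF summable_Suc_iff])
    qed (use Suc in auto)
    then show ?case by blast
  qed
  from this[of N] show ?thesis by simp
qed

lemma summable_alt_gap: "summable (\<lambda>m. (-1) ^ m * gap_sum x m k)"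
  by (rule summable_norm_cancel) (use summable_gap_sum[of k] in \<open>simp add: norm_mult norm_power\<close>)

text \<open>\<open>gap_sum_rec\<close> is summed with alternating signs; lowering \<open>m\<close>
  by one flips the sign of the product term.\<close>

lemma alt_gap_rec: "alt_gap k = alt_gap (Suc k) - x k * x (k + 1) * alt_gap (k + 2)"
proof -
  have head: "alt_gap j = 1 + (\<Sum>m. (-1) ^ Suc m * gap_sum x (Suc m) j)" for j
    unfolding alt_gap_def using suminf_split_head[OF summable_alt_gap[of j]] by simp
  have s: "summable (\<lambda>m. (-1) ^ Suc m * gap_sum x (Suc m) (Suc k))"
    by (rule iffD2[OF summable_Suc_iff summable_alt_gap])
  have "(\<Sum>m. (-1) ^ Suc m * gap_sum x (Suc m) k)
      = (\<Sum>m. (-1) ^ Suc m * gap_sum x (Suc m) (Suc k) - x k * x (k + 1) * ((-1) ^ m * gap_sum x m (k + 2)))"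
    by (subst gap_sum_rec) (simp add: algebra_simps del: gap_sum.simps)
  also have "\<dots> = (\<Sum>m. (-1) ^ Suc m * gap_sum x (Suc m) (Suc k)) - x k * x (k + 1) * alt_gap (k + 2)"
    unfolding alt_gap_def suminf_mult[OF summable_alt_gap, symmetric]
    by (rule suminf_diff[OF s summable_mult[OF summable_alt_gap], symmetric])
  finally show ?thesis using head[of k] head[of "Suc k"] by simp
qed

lemma frakF_eq: "frakF x = alt_gap 0"
  unfolding frakF_def alt_gap_def using suminf_split_head[OF summable_alt_gap[of 0]] by simp

lemma alt_gap_tendsto_1: "alt_gap \<longlonglongrightarrow> 1"
proof -
  have le: "norm (alt_gap k - 1) \<le> tail k / (1 - tail k)" if t: "tail k < 1" for k
  proof -
    have "alt_gap k - 1 = (\<Sum>m. (-1) ^ Suc m * gap_sum x (Suc m) k)"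
      unfolding alt_gap_def using suminf_split_head[OF summable_alt_gap[of k]] by simp
    also have "norm \<dots> \<le> (\<Sum>m. tail k ^ Suc m)"
    proof (rule norm_suminf_le)
      show "summable (\<lambda>m. tail k ^ Suc m)"
        using t tail_nonneg[of k] by (intro iffD2[OF summable_Suc_iff] summable_geometric) auto
      show "norm ((-1) ^ Suc m * gap_sum x (Suc m) k) \<le> tail k ^ Suc m" for m
        using norm_gap_sum_le[of "Suc m" k] by (simp add: norm_mult norm_power del: gap_sum.simps)
    qed
    also have "\<dots> = tail k / (1 - tail k)"
      using t tail_nonneg[of k] suminf_geometric[of "tail k"] suminf_mult[OF summable_geometric[of "tail k"], of "tail k"] by simp
    finally show ?thesis .
  qed
  have "(\<lambda>k. tail k / (1 - tail k)) \<longlonglongrightarrow> 0 / (1 - 0)"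
    by (intro tendsto_intros tail_tendsto) auto
  then have "(\<lambda>k. tail k / (1 - tail k)) \<longlonglongrightarrow> 0" by simp
  moreover have "\<forall>\<^sub>F k in sequentially. norm (alt_gap k - 1) \<le> tail k / (1 - tail k)"
    using order_tendstoD(2)[OF tail_tendsto, of 1] by (auto elim!: eventually_mono intro: le)
  ultimately have "(\<lambda>k. alt_gap k - 1) \<longlonglongrightarrow> 0"
    by (rule Lim_null_comparison[rotated])
  then show ?thesis by (rule LIM_zero_cancel)
qed

end

section \<open>Identification with the backward solution\<close>

lemma jacobi_gamma_pos: "(\<And>n. w n > 0) \<Longrightarrow> jacobi_gamma w n > 0"
  by (induction n) auto

text \<open>Only products of neighbouring entries enter \<open>frakF\<close>, so this relation
  replaces all \<open>jacobi_gamma\<close> by \<open>w\<close>.\<close>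

lemma jacobi_gamma_mult_Suc:
  "(\<And>n. w n > 0) \<Longrightarrow> jacobi_gamma w n * jacobi_gamma w (Suc n) = w n"
  using jacobi_gamma_pos[of w n] by auto

text \<open>\<open>jacobi_H lam w k\<close> is the entire function \<open>\<G>\<close> of the Jacobi matrix shifted by \<open>k\<close>.\<close>

definition jacobi_H :: "(nat \<Rightarrow> real) \<Rightarrow> (nat \<Rightarrow> real) \<Rightarrow> nat \<Rightarrow> complex \<Rightarrow> complex" where
  "jacobi_H lam w k u =
     rec_sol (\<lambda>n. 1 - u * complex_of_real (lam n)) (\<lambda>n. u\<^sup>2 * (complex_of_real (w n))\<^sup>2) k"

text \<open>A majorant for the coefficients of \<open>jacobi_H\<close> valid for all
  \<open>u\<close> with \<open>norm u <= R\<close> at once.\<close>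

definition jacobi_eps :: "(nat \<Rightarrow> real) \<Rightarrow> (nat \<Rightarrow> real) \<Rightarrow> real \<Rightarrow> nat \<Rightarrow> real" where
  "jacobi_eps lam w R n = R * \<bar>lam n\<bar> + R\<^sup>2 * (w n)\<^sup>2"

locale jacobi =
  fixes lam w :: "nat \<Rightarrow> real"
  assumes lam_l1: "summable (\<lambda>n. \<bar>lam n\<bar>)"
    and w_pos: "\<And>n. w n > 0"
    and w_l2: "summable (\<lambda>n. (w n)\<^sup>2)"
begin

lemma summable_rec_jacobi:
  assumes "norm u \<le> R"
  shows "summable_rec (\<lambda>n. 1 - u * complex_of_real (lam n)) (\<lambda>n. u\<^sup>2 * (complex_of_real (w n))\<^sup>2)
    (jacobi_eps lam w R)"
proof
  have "0 \<le> R" using assms norm_ge_zero order_trans by blast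
  then show "norm (1 - u * complex_of_real (lam k) - 1) + norm (u\<^sup>2 * (complex_of_real (w k))\<^sup>2)
      \<le> jacobi_eps lam w R k" for k
    using assms by (auto simp: jacobi_eps_def norm_mult norm_power intro!: add_mono mult_right_mono power_mono)
  show "summable (jacobi_eps lam w R)"
    unfolding jacobi_eps_def[abs_def] by (intro summable_add summable_mult lam_l1 w_l2)
qed

lemma jacobi_H_rec:
  "jacobi_H lam w k u = (1 - u * complex_of_real (lam k)) * jacobi_H lam w (Suc k) u
     - u\<^sup>2 * (complex_of_real (w k))\<^sup>2 * jacobi_H lam w (Suc (Suc k)) u"
  unfolding jacobi_H_def by (rule summable_rec.rec_sol_rec[OF summable_rec_jacobi[OF order_refl]])

lemma jacobi_H_tendsto_1: "(\<lambda>k. jacobi_H lam w k u) \<longlonglongrightarrow> 1"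
  unfolding jacobi_H_def by (rule summable_rec.rec_sol_tendsto_1[OF summable_rec_jacobi[OF order_refl]])

lemma jacobi_H_unique:
  assumes "\<And>k. y k = (1 - u * complex_of_real (lam k)) * y (Suc k)
     - u\<^sup>2 * (complex_of_real (w k))\<^sup>2 * y (Suc (Suc k))" "y \<longlonglongrightarrow> 1"
  shows "y k = jacobi_H lam w k u"
  unfolding jacobi_H_def by (rule summable_rec.rec_sol_unique[OF summable_rec_jacobi[OF order_refl] assms])

lemma norm_jacobi_H_le: "norm u \<le> R \<Longrightarrow> norm (jacobi_H lam w k u) \<le> exp (suminf (jacobi_eps lam w R))"
  unfolding jacobi_H_def by (rule summable_rec.norm_rec_sol_le[OF summable_rec_jacobi])

lemma holomorphic_jacobi_H: "jacobi_H lam w k holomorphic_on UNIV"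
proof -
  \<comment> \<open>The majorant depends on the radius, so holomorphy is obtained on balls that
    exhaust the plane.\<close>
  have "jacobi_H lam w k holomorphic_on ball 0 (norm z + 1)" for z
    unfolding jacobi_H_def
    by (rule holomorphic_on_rec_sol[OF open_ball _ _ summable_rec_jacobi[of _ "norm z + 1"]])
       (auto intro!: holomorphic_intros)
  then have "jacobi_H lam w k field_differentiable at z" for z
    by (rule holomorphic_on_imp_differentiable_at[where s = "ball 0 (norm z + 1)"]) auto
  then show ?thesis by (simp add: holomorphic_on_def)
qed

lemma jacobi_H_0: "jacobi_H lam w k 0 = 1"
  using jacobi_H_unique[of "\<lambda>_. 1" 0 k] by simp

lemma lam_tendsto_0: "lam \<longlonglongrightarrow> 0"
  using summable_LIMSEQ_zero[OF lam_l1] by (simp add: tendsto_rabs_zero_iff)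

lemma w_tendsto_0: "w \<longlonglongrightarrow> 0"
proof -
  have "(\<lambda>n. sqrt ((w n)\<^sup>2)) \<longlonglongrightarrow> sqrt 0"
    by (intro tendsto_real_sqrt summable_LIMSEQ_zero[OF w_l2])
  then show ?thesis using w_pos by (simp add: less_imp_le)
qed

text \<open>The tail products \<open>c k\<close> of \<open>jacobi_phi\<close>, multiplied by
  \<open>alt_gap k\<close>, solve the recurrence of \<open>jacobi_H\<close> and tend to 1, so
  uniqueness applies. At index 0 they give the left-hand side.\<close>

lemma jacobi_phi_mult_F:
  assumes u: "u \<noteq> 0" "\<And>n. 1 - u * complex_of_real (lam n) \<noteq> 0"
  shows "jacobi_phi lam u * jacobi_F lam w (inverse u) = jacobi_H lam w 0 u"
proof -
  define a where "a = (\<lambda>n. 1 - u * complex_of_real (lam n))"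
  define x where "x = (\<lambda>n. complex_of_real ((jacobi_gamma w n)\<^sup>2) / (complex_of_real (lam n) - inverse u))"
  have a_nz: "a n \<noteq> 0" for n using u by (simp add: a_def)
  have den: "complex_of_real (lam n) - inverse u = - a n / u" for n
    using u by (simp add: a_def field_simps)
  have xx: "x n * x (n + 1) = u\<^sup>2 * (complex_of_real (w n))\<^sup>2 / (a n * a (Suc n))" for n
  proof -
    have "x n * x (n + 1) = complex_of_real ((jacobi_gamma w n * jacobi_gamma w (Suc n))\<^sup>2) * u\<^sup>2 / (a n * a (Suc n))"
      unfolding x_def den by (simp add: power2_eq_square field_simps del: jacobi_gamma.simps)
    then show ?thesis using jacobi_gamma_mult_Suc[of w n] w_pos by simp
  qed
  have a_lim: "a \<longlonglongrightarrow> 1 - u * of_real 0"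
    unfolding a_def by (intro tendsto_intros lam_tendsto_0)
  \<comment> \<open>As \<open>a n\<close> tends to 1, the products of neighbours are eventually
    bounded by a constant times the square of \<open>w n\<close>; the \<open>+ 1\<close> below is
    the slack above the limit.\<close>
  have "(\<lambda>n. norm (u\<^sup>2 / (a n * a (Suc n)))) \<longlonglongrightarrow> norm (u\<^sup>2 / ((1 - u * of_real 0) * (1 - u * of_real 0)))"
    by (intro tendsto_intros a_lim LIMSEQ_Suc[OF a_lim]) auto
  then have "(\<lambda>n. norm (u\<^sup>2 / (a n * a (Suc n)))) \<longlonglongrightarrow> (norm u)\<^sup>2" by (simp add: norm_power)
  then have "\<forall>\<^sub>F n in sequentially. norm (u\<^sup>2 / (a n * a (Suc n))) < (norm u)\<^sup>2 + 1"
    by (rule order_tendstoD) simp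
  then have ev: "\<forall>\<^sub>F n in sequentially. norm (norm (x n * x (n + 1))) \<le> ((norm u)\<^sup>2 + 1) * (w n)\<^sup>2"
  proof eventually_elim
    case (elim n)
    have "norm (x n * x (n + 1)) = norm (u\<^sup>2 / (a n * a (Suc n))) * (w n)\<^sup>2"
      unfolding xx by (simp add: norm_mult norm_divide norm_power)
    also have "\<dots> \<le> ((norm u)\<^sup>2 + 1) * (w n)\<^sup>2"
      using elim by (intro mult_right_mono) auto
    finally show ?case by simp
  qed
  interpret x: summable_adjacent x
    by standard (rule summable_comparison_test_ev[OF ev summable_mult[OF w_l2]])
  define c where "c = (\<lambda>k. \<Prod>n. a (n + k))"
  have conv: "convergent_prod a"
  proof (rule abs_convergent_prod_imp_convergent_prod, subst abs_convergent_prod_conv_summable)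
    show "summable (\<lambda>i. norm (a i - 1))"
      using summable_mult[OF lam_l1, of "norm u"] by (simp add: a_def norm_mult)
  qed
  have conv': "convergent_prod (\<lambda>n. a (n + k))" for k
    using conv a_nz by (subst convergent_prod_iff_shift) auto
  have c_rec: "c k = a k * c (Suc k)" for k
  proof -
    have "c k = c (Suc k) * a k"
      unfolding c_def using prodinf_split_head[OF conv'[of k]] a_nz by simp
    then show ?thesis by simp
  qed
  have c0: "c 0 \<noteq> 0" unfolding c_def using prodinf_nonzero[OF conv'[of 0]] a_nz by simp
  have c_eq: "c k = c 0 / (\<Prod>n<k. a n)" for k
  proof (induction k)
    case (Suc k)
    have "c (Suc k) = c k / a k" using c_rec[of k] a_nz[of k] by simp
    then show ?case using Suc by simp
  qed simp
  have "c \<longlonglongrightarrow> c 0 / c 0"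
  proof -
    have "(\<lambda>k. \<Prod>n<Suc k. a n) \<longlonglongrightarrow> c 0"
      using convergent_prod_LIMSEQ[OF conv] by (simp add: c_def lessThan_Suc_atMost)
    then have "(\<lambda>k. \<Prod>n<k. a n) \<longlonglongrightarrow> c 0" by (rule LIMSEQ_imp_Suc)
    then have "(\<lambda>k. c 0 / (\<Prod>n<k. a n)) \<longlonglongrightarrow> c 0 / c 0" by (intro tendsto_intros c0)
    then show ?thesis by (simp only: c_eq[symmetric])
  qed
  then have c_lim: "c \<longlonglongrightarrow> 1" using c0 by simp
  define y where "y = (\<lambda>k. c k * x.alt_gap k)"
  have "y 0 = jacobi_H lam w 0 u"
  proof (rule jacobi_H_unique)
    show "y \<longlonglongrightarrow> 1"
      unfolding y_def using tendsto_mult[OF c_lim x.alt_gap_tendsto_1] by simp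
    fix k
    have "y k = c k * x.alt_gap (Suc k) - c k * (x k * x (k + 1)) * x.alt_gap (k + 2)"
      unfolding y_def by (subst x.alt_gap_rec) (simp add: algebra_simps)
    also have "c k * (x k * x (k + 1)) = u\<^sup>2 * (complex_of_real (w k))\<^sup>2 * c (Suc (Suc k))"
      unfolding xx c_rec[of k] c_rec[of "Suc k"] using a_nz[of k] a_nz[of "Suc k"] by (simp add: field_simps)
    also have "c k = a k * c (Suc k)" by (rule c_rec)
    finally show "y k = (1 - u * complex_of_real (lam k)) * y (Suc k)
        - u\<^sup>2 * (complex_of_real (w k))\<^sup>2 * y (Suc (Suc k))"
      by (simp add: y_def a_def mult.assoc)
  qed
  moreover have "jacobi_phi lam u = c 0" by (simp add: jacobi_phi_def c_def a_def)
  moreover have "jacobi_F lam w (inverse u) = x.alt_gap 0"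
    unfolding jacobi_F_def x_def[symmetric] by (rule x.frakF_eq)
  ultimately show ?thesis by (simp add: y_def)
qed

lemma inverse_in_range_lam_iff:
  "u \<noteq> 0 \<Longrightarrow> inverse u \<in> range (\<lambda>n. complex_of_real (lam n)) \<longleftrightarrow> (\<exists>n. 1 - u * complex_of_real (lam n) = 0)"
  by (auto simp: field_simps image_iff)

text \<open>At an exceptional point the product agrees with the continuous function
  \<open>jacobi_H lam w 0\<close> on a punctured neighbourhood, so the limit in
  \<open>jacobi_G\<close> is its value.\<close>

lemma jacobi_G_eq: "jacobi_G lam w u = jacobi_H lam w 0 u"
proof -
  consider "u = 0" | "u \<noteq> 0" "inverse u \<notin> range (\<lambda>n. complex_of_real (lam n))"
    | "u \<noteq> 0" "inverse u \<in> range (\<lambda>n. complex_of_real (lam n))" by blast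
  then show ?thesis
  proof cases
    case 1
    then show ?thesis by (simp add: jacobi_G_def jacobi_H_0)
  next
    case 2
    then show ?thesis using jacobi_phi_mult_F[of u] inverse_in_range_lam_iff[of u] by (simp add: jacobi_G_def)
  next
    case 3
    have "\<forall>\<^sub>F n in sequentially. norm (lam n) < norm (inverse u) / 2"
      using order_tendstoD(2)[OF tendsto_norm_zero[OF lam_tendsto_0], of "norm (inverse u) / 2"] 3 by simp
    then obtain N where N: "\<And>n. n \<ge> N \<Longrightarrow> norm (lam n) < norm (inverse u) / 2"
      by (auto simp: eventually_sequentially)
    \<comment> \<open>Exceptional points of norm below \<open>2 * norm u\<close> come only from
      \<open>n < N\<close>; they lie in the finite set \<open>B\<close>, which a punctured
      neighbourhood of \<open>u\<close> avoids.\<close>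
    define B where "B = (\<lambda>n. inverse (complex_of_real (lam n))) ` {..<N}"
    have "\<forall>\<^sub>F v in at u. \<forall>b\<in>B. v \<noteq> b"
      by (intro eventually_ball_finite) (auto simp: B_def eventually_neq_at_within)
    moreover have "\<forall>\<^sub>F v in at u. v \<noteq> 0"
      using 3 by (auto simp: eventually_neq_at_within)
    moreover have "\<forall>\<^sub>F v in at u. norm v < 2 * norm u"
      using 3 by (intro order_tendstoD(2)[OF tendsto_norm[OF tendsto_ident_at]]) auto
    ultimately have "\<forall>\<^sub>F v in at u. jacobi_H lam w 0 v = jacobi_phi lam v * jacobi_F lam w (inverse v)"
    proof eventually_elim
      case (elim v)
      have "1 - v * complex_of_real (lam n) \<noteq> 0" for n
      proof
        assume "1 - v * complex_of_real (lam n) = 0"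
        then have v: "v * complex_of_real (lam n) = 1" by simp
        then have v': "v = inverse (complex_of_real (lam n))"
          by (metis inverse_unique mult.commute)
        show False
        proof (cases "n < N")
          case True
          then show False using elim v' by (auto simp: B_def)
        next
          case False
          then have "norm v * norm (lam n) \<le> norm v * (norm (inverse u) / 2)"
            using N[of n] by (intro mult_left_mono) auto
          also have "\<dots> < 2 * norm u * (norm (inverse u) / 2)"
            using elim 3 by (intro mult_strict_right_mono) auto
          also have "\<dots> = 1" using 3 by (simp add: norm_inverse)
          finally have "norm (v * complex_of_real (lam n)) < 1" by (simp add: norm_mult)
          then show False using v by simp
        qed
      qed
      then show ?case using jacobi_phi_mult_F[of v] elim by simp
    qed
    moreover have "(jacobi_H lam w 0 \<longlongrightarrow> jacobi_H lam w 0 u) (at u)"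
      using holomorphic_on_imp_continuous_on[OF holomorphic_jacobi_H]
      by (simp add: continuous_on_eq_continuous_at isCont_def)
    ultimately have "((\<lambda>v. jacobi_phi lam v * jacobi_F lam w (inverse v)) \<longlongrightarrow> jacobi_H lam w 0 u) (at u)"
      by (rule Lim_transform_eventually[rotated])
    then show ?thesis using 3 by (simp add: jacobi_G_def tendsto_Lim)
  qed
qed

lemma jacobi_shift: "jacobi (\<lambda>n. lam (n + 1)) (\<lambda>n. w (n + 1))"
  using lam_l1 w_l2 w_pos summable_Suc_iff[of "\<lambda>n. \<bar>lam n\<bar>"] summable_Suc_iff[of "\<lambda>n. (w n)\<^sup>2"]
  by unfold_locales simp_all

text \<open>Dropping the first term of the solution leaves a solution for the shifted matrix with
  limit 1. By uniqueness, the restart of \<open>jacobi_gamma\<close> at 1 need not be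
  followed.\<close>

lemma jacobi_G_shift_eq: "jacobi_G (\<lambda>n. lam (n + 1)) (\<lambda>n. w (n + 1)) u = jacobi_H lam w 1 u"
proof -
  interpret s: jacobi "\<lambda>n. lam (n + 1)" "\<lambda>n. w (n + 1)" by (rule jacobi_shift)
  have "jacobi_H lam w (Suc 0) u = jacobi_H (\<lambda>n. lam (n + 1)) (\<lambda>n. w (n + 1)) 0 u"
  proof (rule s.jacobi_H_unique)
    show "(\<lambda>k. jacobi_H lam w (Suc k) u) \<longlonglongrightarrow> 1"
      by (rule LIMSEQ_Suc[OF jacobi_H_tendsto_1])
    show "jacobi_H lam w (Suc k) u
        = (1 - u * complex_of_real (lam (k + 1))) * jacobi_H lam w (Suc (Suc k)) u
          - u\<^sup>2 * (complex_of_real (w (k + 1)))\<^sup>2 * jacobi_H lam w (Suc (Suc (Suc k))) u" for k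
      using jacobi_H_rec[of "Suc k" u] by (simp only: Suc_eq_plus1)
  qed
  then show ?thesis by (subst s.jacobi_G_eq) simp
qed

end

subsection \<open>The measure of orthogonality\<close>

context real_distribution
begin

text \<open>The complement of the support is the union of all open null sets, and by Lindelof
  countably many of them suffice.\<close>

lemma AE_in_measure_support: "AE x in M. x \<in> measure_support M"
proof -
  define F where "F = {U. open U \<and> emeasure M U = 0}"
  obtain F' where F': "F' \<subseteq> F" "countable F'" "\<Union>F' = \<Union>F"
    using Lindelof[of F] unfolding F_def by blast
  have "(\<Union>U\<in>F'. U) \<in> null_sets M"
    using F' by (intro null_sets_UN') (auto simp: F_def null_sets_def)
  then have "\<Union>F \<in> null_sets M" using F' by simp
  moreover have "- \<Union>F = measure_support M"
    unfolding measure_support_def F_def by (auto simp: zero_less_iff_neq_zero)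
  ultimately show ?thesis
    by (intro AE_I'[of "\<Union>F"]) auto
qed

text \<open>A quadratic bound at every centre near \<open>x\<close> gives the distribution function
  derivative 0 there, so it is constant around \<open>x\<close>.\<close>

lemma not_in_measure_supportI:
  assumes "\<eta> > 0"
    and le: "\<And>z \<delta>. \<bar>z - x\<bar> < \<eta> \<Longrightarrow> \<delta> > 0 \<Longrightarrow> measure M {z - \<delta>..z + \<delta>} \<le> K * \<delta>\<^sup>2"
  shows "x \<notin> measure_support M"
proof -
  have diff_le: "\<bar>cdf M y - cdf M z\<bar> \<le> K * (y - z)\<^sup>2" if "\<bar>z - x\<bar> < \<eta>" "y \<noteq> z" for y z
  proof -
    have "\<bar>cdf M y - cdf M z\<bar> = measure M {min y z<..max y z}"
      using cdf_diff_eq[of y z] cdf_diff_eq[of z y] cdf_nondecreasing[of y z] cdf_nondecreasing[of z y] that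
      by (cases "y < z") (auto simp: min_def max_def)
    also have "\<dots> \<le> measure M {z - \<bar>y - z\<bar>..z + \<bar>y - z\<bar>}"
      by (intro finite_measure_mono) auto
    also have "\<dots> \<le> K * \<bar>y - z\<bar>\<^sup>2" using that by (intro le) auto
    finally show ?thesis by simp
  qed
  have deriv: "(cdf M has_field_derivative 0) (at z within ball x \<eta>)" if z: "z \<in> ball x \<eta>" for z
    unfolding has_field_derivative_iff
  proof (rule Lim_null_comparison)
    show "\<forall>\<^sub>F y in at z within ball x \<eta>. norm ((cdf M y - cdf M z) / (y - z)) \<le> K * \<bar>y - z\<bar>"
      unfolding eventually_at_filter
    proof (intro always_eventually allI impI)
      fix y assume "y \<noteq> z"
      then have "norm ((cdf M y - cdf M z) / (y - z)) \<le> K * (y - z)\<^sup>2 / \<bar>y - z\<bar>"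
        using diff_le[of z y] z by (simp add: dist_real_def divide_right_mono abs_minus_commute)
      also have "\<dots> = K * \<bar>y - z\<bar>" using \<open>y \<noteq> z\<close> by (simp add: power2_eq_square divide_simps)
      finally show "norm ((cdf M y - cdf M z) / (y - z)) \<le> K * \<bar>y - z\<bar>" .
    qed
    have "((\<lambda>y. K * \<bar>y - z\<bar>) \<longlongrightarrow> K * \<bar>z - z\<bar>) (at z within ball x \<eta>)"
      by (intro tendsto_intros)
    then show "((\<lambda>y. K * \<bar>y - z\<bar>) \<longlongrightarrow> 0) (at z within ball x \<eta>)" by simp
  qed
  obtain c where c: "\<And>z. z \<in> ball x \<eta> \<Longrightarrow> cdf M z = c"
    using has_field_derivative_zero_constant[OF convex_ball deriv] by blast
  \<comment> \<open>Half the radius keeps both endpoints inside the open ball.\<close>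
  have "measure M {x - \<eta>/2<..x + \<eta>/2} = cdf M (x + \<eta>/2) - cdf M (x - \<eta>/2)"
    using \<open>\<eta> > 0\<close> by (subst cdf_diff_eq) auto
  also have "\<dots> = 0" using c[of "x + \<eta>/2"] c[of "x - \<eta>/2"] \<open>\<eta> > 0\<close> by (simp add: dist_real_def)
  finally have "emeasure M {x - \<eta>/2<..x + \<eta>/2} = 0" by (simp add: emeasure_eq_measure)
  then have "emeasure M {x - \<eta>/2<..<x + \<eta>/2} \<le> 0"
    using emeasure_mono[of "{x - \<eta>/2<..<x + \<eta>/2}" "{x - \<eta>/2<..x + \<eta>/2}" M]
    by (simp add: subset_eq)
  then show ?thesis
    using \<open>\<eta> > 0\<close> unfolding measure_support_def
    by (auto intro!: exI[of _ "{x - \<eta>/2<..<x + \<eta>/2}"])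
qed

lemma cdf_jump: "cdf M x - Lim (at_left x) (cdf M) = measure M {x}"
proof -
  have "Lim (at_left x) (cdf M) = measure M {..<x}"
    by (rule tendsto_Lim[OF _ cdf_at_left]) simp
  moreover have "measure M {..x} = measure M {..<x} + measure M {x}"
    by (subst finite_measure_Union[symmetric]) (auto intro: arg_cong[of _ _ "measure M"])
  ultimately show ?thesis by (simp add: cdf_def2)
qed

end

section \<open>The decaying solution and its finite expansions\<close>

text \<open>\<open>P_1\<close> is kept free of division and \<open>P_rec\<close> free of natural
  subtraction.\<close>

locale jacobi_orthogonality = jacobi lam w + real_distribution \<mu>
  for lam w :: "nat \<Rightarrow> real" and \<mu> :: "real measure" +
  fixes P :: "nat \<Rightarrow> real poly"
  assumes P_0: "\<And>x. poly (P 0) x = 1"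
    and P_1: "\<And>x. w 0 * poly (P (Suc 0)) x = x - lam 0"
    and P_rec: "\<And>n x. x * poly (P (Suc n)) x =
        w n * poly (P n) x + lam (Suc n) * poly (P (Suc n)) x + w (Suc n) * poly (P (Suc (Suc n))) x"
    and orth: "\<And>m n. has_bochner_integral \<mu> (\<lambda>x. poly (P m) x * poly (P n) x) (if m = n then 1 else 0)"
begin

definition wprod :: "nat \<Rightarrow> real" where
  "wprod n = (\<Prod>j<n. w j)"

text \<open>
  For \<open>z = inverse u\<close> this is the solution of the Jacobi recurrence that decays faster than
  geometrically; \<open>jacobi_H lam w 0 u\<close> is its defect at index 0, i.e. \<open>(z - J) (decay u) = jacobi_H lam w 0 u \<cdot> e\<^sub>0\<close>.
\<close>

definition decay :: "complex \<Rightarrow> nat \<Rightarrow> complex" where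
  "decay u n = u ^ Suc n * of_real (wprod n) * jacobi_H lam w (Suc n) u"

text \<open>For nonreal \<open>z = inverse u\<close> these are the partial sums of the orthogonal
  expansion of \<open>jacobi_H lam w 0 u / (z - x)\<close>.\<close>

definition decay_sum :: "complex \<Rightarrow> nat \<Rightarrow> real \<Rightarrow> complex" where
  "decay_sum u N x = (\<Sum>n<Suc N. decay u n * of_real (poly (P n) x))"

text \<open>The Wronskian-like term left at the upper end of a summation by parts.\<close>

definition boundary :: "complex \<Rightarrow> nat \<Rightarrow> real \<Rightarrow> complex" where
  "boundary u N x = of_real (w N) * (decay u (Suc N) * of_real (poly (P N) x) - decay u N * of_real (poly (P (Suc N)) x))"

lemma wprod_Suc: "wprod (Suc n) = wprod n * w n"
  by (simp add: wprod_def)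

lemma wprod_pos: "wprod n > 0"
  unfolding wprod_def by (intro prod_pos) (simp add: w_pos)

lemma decay_0: "decay u 0 = u * jacobi_H lam w 1 u"
  by (simp add: decay_def wprod_def)

lemma decay_rec_0:
  assumes "u \<noteq> 0"
  shows "inverse u * decay u 0 = jacobi_H lam w 0 u + of_real (lam 0) * decay u 0 + of_real (w 0) * decay u (Suc 0)"
  using assms jacobi_H_rec[of 0 u]
  by (simp add: decay_def wprod_def field_simps power2_eq_square)

lemma decay_rec_Suc:
  assumes "u \<noteq> 0"
  shows "inverse u * decay u (Suc n) =
    of_real (w n) * decay u n + of_real (lam (Suc n)) * decay u (Suc n) + of_real (w (Suc n)) * decay u (Suc (Suc n))"
proof -
  have "of_real (w n) * decay u n = u ^ Suc n * of_real (wprod (Suc n)) * jacobi_H lam w (Suc n) u"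
    by (simp add: decay_def wprod_Suc)
  also have "\<dots> = u ^ Suc n * of_real (wprod (Suc n)) *
      ((1 - u * of_real (lam (Suc n))) * jacobi_H lam w (Suc (Suc n)) u
       - u\<^sup>2 * (of_real (w (Suc n)))\<^sup>2 * jacobi_H lam w (Suc (Suc (Suc n))) u)"
    by (subst jacobi_H_rec) (rule refl)
  finally show ?thesis using assms
    by (simp add: decay_def wprod_Suc[of "Suc n"] algebra_simps power2_eq_square)
qed

text \<open>A discrete Green identity: \<open>decay u\<close> and the values of \<open>P\<close>
  obey the same three-term recurrence, so the terms telescope, leaving the defect at index 0 and the
  boundary term at \<open>N\<close>.\<close>

lemma decay_sum_eq:
  assumes "u \<noteq> 0"
  shows "(inverse u - of_real x) * decay_sum u N x = jacobi_H lam w 0 u + boundary u N x"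
proof (induction N)
  case 0
  have 1: "of_real (w 0) * complex_of_real (poly (P (Suc 0)) x) = of_real x - of_real (lam 0)"
    using P_1[of x] by (metis of_real_diff of_real_mult)
  have "(inverse u - of_real x) * decay_sum u 0 x = inverse u * decay u 0 - of_real x * decay u 0"
    by (simp add: decay_sum_def P_0 algebra_simps)
  also have "\<dots> = jacobi_H lam w 0 u + of_real (w 0) * decay u (Suc 0)
      - decay u 0 * (of_real x - of_real (lam 0))"
    by (simp add: decay_rec_0[OF assms] algebra_simps)
  also have "\<dots> = jacobi_H lam w 0 u + boundary u 0 x"
    unfolding 1[symmetric] by (simp add: boundary_def P_0 algebra_simps)
  finally show ?case .
next
  case (Suc N)
  define p where "p = (\<lambda>n. complex_of_real (poly (P n) x))"
  have 1: "of_real x * p (Suc N) =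
      of_real (w N) * p N + of_real (lam (Suc N)) * p (Suc N) + of_real (w (Suc N)) * p (Suc (Suc N))"
    using P_rec[of x N] unfolding p_def by (metis of_real_add of_real_mult)
  have "(inverse u - of_real x) * decay_sum u (Suc N) x
      = jacobi_H lam w 0 u + boundary u N x + (inverse u - of_real x) * (decay u (Suc N) * p (Suc N))"
    using Suc by (simp add: decay_sum_def p_def algebra_simps)
  also have "(inverse u - of_real x) * (decay u (Suc N) * p (Suc N))
      = (inverse u * decay u (Suc N)) * p (Suc N) - decay u (Suc N) * (of_real x * p (Suc N))"
    by (simp add: algebra_simps)
  also have "jacobi_H lam w 0 u + boundary u N x + \<dots> = jacobi_H lam w 0 u + boundary u (Suc N) x"
    unfolding 1 decay_rec_Suc[OF assms] boundary_def by (simp add: p_def algebra_simps)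
  finally show ?case .
qed

text \<open>Successive terms have ratio \<open>R^2 * (w n)^2\<close>, which tends to 0.\<close>

lemma summable_wprod_power: "summable (\<lambda>n. (R ^ Suc n * wprod n)\<^sup>2)"
proof -
  have "(\<lambda>n. R\<^sup>2 * (w n)\<^sup>2) \<longlonglongrightarrow> R\<^sup>2 * 0\<^sup>2"
    by (intro tendsto_intros w_tendsto_0)
  then have "\<forall>\<^sub>F n in sequentially. R\<^sup>2 * (w n)\<^sup>2 < 1 / 2"
    by (intro order_tendstoD(2)) auto
  then obtain N where N: "\<And>n. n \<ge> N \<Longrightarrow> R\<^sup>2 * (w n)\<^sup>2 < 1 / 2"
    by (auto simp: eventually_sequentially)
  show ?thesis
  proof (rule summable_ratio_test)
    fix n assume "n \<ge> N"
    have "norm ((R ^ Suc (Suc n) * wprod (Suc n))\<^sup>2) = R\<^sup>2 * (w n)\<^sup>2 * norm ((R ^ Suc n * wprod n)\<^sup>2)"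
      by (simp add: wprod_Suc power_mult_distrib algebra_simps)
    also have "\<dots> \<le> 1/2 * norm ((R ^ Suc n * wprod n)\<^sup>2)"
      using N[OF \<open>n \<ge> N\<close>] by (intro mult_right_mono) auto
    finally show "norm ((R ^ Suc (Suc n) * wprod (Suc n))\<^sup>2) \<le> 1/2 * norm ((R ^ Suc n * wprod n)\<^sup>2)" .
  qed simp
qed

lemma norm_decay_le:
  assumes "norm u \<le> R"
  shows "norm (decay u n) \<le> exp (suminf (jacobi_eps lam w R)) * (R ^ Suc n * wprod n)"
proof -
  have "R \<ge> 0" using assms norm_ge_zero order_trans by blast
  have "norm (decay u n) = norm u ^ Suc n * wprod n * norm (jacobi_H lam w (Suc n) u)"
    using wprod_pos[of n] by (simp add: decay_def norm_mult norm_power)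
  also have "\<dots> \<le> (R ^ Suc n * wprod n) * exp (suminf (jacobi_eps lam w R))"
    using wprod_pos[of n] assms norm_jacobi_H_le[OF assms] \<open>R \<ge> 0\<close>
    by (intro mult_mono mult_right_mono power_mono) (auto simp: less_imp_le)
  finally show ?thesis by (simp add: mult.commute)
qed

lemma decay_tendsto_0: "decay u \<longlonglongrightarrow> 0"
proof -
  define c where "c = exp (suminf (jacobi_eps lam w (norm u)))"
  have "(\<lambda>n. sqrt ((norm u ^ Suc n * wprod n)\<^sup>2)) \<longlonglongrightarrow> sqrt 0"
    by (intro tendsto_real_sqrt summable_LIMSEQ_zero[OF summable_wprod_power])
  then have "(\<lambda>n. norm u ^ Suc n * wprod n) \<longlonglongrightarrow> 0"
    using wprod_pos by (simp add: less_imp_le real_sqrt_mult abs_mult)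
  then have "(\<lambda>n. c * (norm u ^ Suc n * wprod n)) \<longlonglongrightarrow> 0"
    by (rule tendsto_mult_right_zero)
  then show ?thesis
    by (rule Lim_null_comparison[rotated]) (use norm_decay_le[OF order_refl, of u] in \<open>simp add: c_def\<close>)
qed

text \<open>\<open>C\<close> depends on \<open>R\<close> only; uniformity in \<open>u\<close> lets
  the estimates hold at all points near a given one with the same constant.\<close>

lemma sum_norm_decay_bounded:
  "\<exists>C>0. \<forall>u N. norm u \<le> R \<longrightarrow> (\<Sum>n<N. (norm (decay u n))\<^sup>2) \<le> C"
proof (intro exI conjI allI impI)
  define c where "c = exp (suminf (jacobi_eps lam w R))"
  define s where "s = (\<Sum>n. (R ^ Suc n * wprod n)\<^sup>2)"
  have s: "s \<ge> 0" unfolding s_def by (intro suminf_nonneg summable_wprod_power) auto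
  \<comment> \<open>The summand 1 only makes the constant positive.\<close>
  show "c\<^sup>2 * s + 1 > 0" using s by (simp add: add_nonneg_pos)
  fix u :: complex and N assume u: "norm u \<le> R"
  have "(\<Sum>n<N. (norm (decay u n))\<^sup>2) \<le> (\<Sum>n<N. c\<^sup>2 * (R ^ Suc n * wprod n)\<^sup>2)"
  proof (rule sum_mono)
    fix n
    have "(norm (decay u n))\<^sup>2 \<le> (c * (R ^ Suc n * wprod n))\<^sup>2"
      using norm_decay_le[OF u, of n] by (intro power_mono) (auto simp: c_def)
    then show "(norm (decay u n))\<^sup>2 \<le> c\<^sup>2 * (R ^ Suc n * wprod n)\<^sup>2" by (simp add: power_mult_distrib)
  qed
  also have "\<dots> = c\<^sup>2 * (\<Sum>n<N. (R ^ Suc n * wprod n)\<^sup>2)" by (simp add: sum_distrib_left)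
  also have "\<dots> \<le> c\<^sup>2 * s"
    unfolding s_def by (intro mult_left_mono sum_le_suminf summable_wprod_power) auto
  finally show "(\<Sum>n<N. (norm (decay u n))\<^sup>2) \<le> c\<^sup>2 * s + 1" by simp
qed

section \<open>Integrals from orthogonality\<close>

lemma orth_sum_real:
  "finite A \<Longrightarrow> has_bochner_integral \<mu> (\<lambda>x. (\<Sum>n\<in>A. c n * poly (P n) x)\<^sup>2) (\<Sum>n\<in>A. (c n)\<^sup>2)"
proof -
  assume A: "finite A"
  have "has_bochner_integral \<mu> (\<lambda>x. \<Sum>m\<in>A. \<Sum>n\<in>A. c m * c n * (poly (P m) x * poly (P n) x))
      (\<Sum>m\<in>A. \<Sum>n\<in>A. c m * c n * (if m = n then 1 else 0))"
    by (intro has_bochner_integral_sum has_bochner_integral_mult_right orth)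
  also have "(\<lambda>x. \<Sum>m\<in>A. \<Sum>n\<in>A. c m * c n * (poly (P m) x * poly (P n) x)) =
      (\<lambda>x. (\<Sum>n\<in>A. c n * poly (P n) x)\<^sup>2)"
    by (simp add: power2_eq_square sum_product algebra_simps)
  also have "(\<Sum>m\<in>A. \<Sum>n\<in>A. c m * c n * (if m = n then 1 else 0)) = (\<Sum>n\<in>A. (c n)\<^sup>2)"
    using A by (simp add: power2_eq_square if_distrib[of "\<lambda>x. _ * x"] cong: if_cong)
  finally show ?thesis .
qed

text \<open>The \<open>P n\<close> are real on the line, so real and imaginary parts
  separate.\<close>

lemma orth_sum:
  fixes c :: "nat \<Rightarrow> complex"
  assumes "finite A"
  shows "has_bochner_integral \<mu> (\<lambda>x. (norm (\<Sum>n\<in>A. c n * of_real (poly (P n) x)))\<^sup>2) (\<Sum>n\<in>A. (norm (c n))\<^sup>2)"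
proof -
  have "has_bochner_integral \<mu>
      (\<lambda>x. (\<Sum>n\<in>A. Re (c n) * poly (P n) x)\<^sup>2 + (\<Sum>n\<in>A. Im (c n) * poly (P n) x)\<^sup>2)
      ((\<Sum>n\<in>A. (Re (c n))\<^sup>2) + (\<Sum>n\<in>A. (Im (c n))\<^sup>2))"
    by (intro has_bochner_integral_add orth_sum_real assms)
  then show ?thesis
    by (simp add: cmod_power2 sum.distrib)
qed

lemma integrable_P: "integrable \<mu> (\<lambda>x. poly (P n) x)"
  using orth[of n 0] by (auto simp: P_0 has_bochner_integral_iff)

lemma integral_P: "(LINT x|\<mu>. poly (P n) x) = (if n = 0 then 1 else 0)"
  using orth[of n 0] by (auto simp: P_0 has_bochner_integral_iff split: if_splits)

text \<open>From \<open>|t| <= (1 + t^2) / 2\<close> and the normalisation of both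
  \<open>\<mu>\<close> and \<open>P n\<close>.\<close>

lemma integral_abs_P_le: "(LINT x|\<mu>. \<bar>poly (P n) x\<bar>) \<le> 1"
proof -
  have sq: "has_bochner_integral \<mu> (\<lambda>x. (poly (P n) x)\<^sup>2) 1"
    using orth[of n n] by (simp add: power2_eq_square)
  have "(LINT x|\<mu>. \<bar>poly (P n) x\<bar>) \<le> (LINT x|\<mu>. (1 + (poly (P n) x)\<^sup>2) / 2)"
  proof (rule integral_mono)
    show "integrable \<mu> (\<lambda>x. (1 + (poly (P n) x)\<^sup>2) / 2)"
      using sq by (auto simp: has_bochner_integral_iff)
    show "\<bar>poly (P n) x\<bar> \<le> (1 + (poly (P n) x)\<^sup>2) / 2" for x
      using zero_le_power2[of "\<bar>poly (P n) x\<bar> - 1"] by (simp add: power2_diff)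
  qed (simp add: integrable_P)
  also have "\<dots> = 1"
    using sq prob_space by (simp add: has_bochner_integral_iff)
  finally show ?thesis .
qed

lemma integrable_decay_sum: "integrable \<mu> (decay_sum u N)"
  unfolding decay_sum_def[abs_def] by (intro Bochner_Integration.integrable_sum integrable_mult_right integrable_of_real integrable_P)

text \<open>Only the component along \<open>P 0 = 1\<close> survives, so the value does not depend
  on \<open>N\<close>.\<close>

lemma integral_decay_sum: "integral\<^sup>L \<mu> (decay_sum u N) = decay u 0"
proof -
  have "integral\<^sup>L \<mu> (decay_sum u N) = (\<Sum>n<Suc N. LINT x|\<mu>. decay u n * of_real (poly (P n) x))"
    unfolding decay_sum_def[abs_def]
    by (intro Bochner_Integration.integral_sum integrable_mult_right integrable_of_real integrable_P)
  also have "\<dots> = (\<Sum>n<Suc N. decay u n * (if n = 0 then 1 else 0))"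
    by (intro sum.cong refl) (simp add: integral_P integrable_of_real integrable_P)
  also have "\<dots> = decay u 0" by (simp add: if_distrib[of "\<lambda>x. _ * x"] cong: if_cong)
  finally show ?thesis .
qed

lemma integrable_norm_sq_decay_sum: "integrable \<mu> (\<lambda>x. (norm (decay_sum u N x))\<^sup>2)"
  using orth_sum[of "{..<Suc N}" "decay u"] by (auto simp: decay_sum_def has_bochner_integral_iff)

lemma integral_norm_sq_decay_sum: "(LINT x|\<mu>. (norm (decay_sum u N x))\<^sup>2) = (\<Sum>n<Suc N. (norm (decay u n))\<^sup>2)"
  using orth_sum[of "{..<Suc N}" "decay u"] by (auto simp: decay_sum_def has_bochner_integral_iff)

lemma integrable_boundary: "integrable \<mu> (boundary u N)"
  unfolding boundary_def[abs_def]
  by (intro integrable_mult_right Bochner_Integration.integrable_diff integrable_of_real integrable_P)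

lemma integral_norm_boundary_le:
  "(LINT x|\<mu>. norm (boundary u N x)) \<le> w N * (norm (decay u (Suc N)) + norm (decay u N))"
proof -
  have "(LINT x|\<mu>. norm (boundary u N x)) \<le>
      (LINT x|\<mu>. w N * (norm (decay u (Suc N)) * \<bar>poly (P N) x\<bar> + norm (decay u N) * \<bar>poly (P (Suc N)) x\<bar>))"
  proof (rule integral_mono)
    show "norm (boundary u N x) \<le> w N * (norm (decay u (Suc N)) * \<bar>poly (P N) x\<bar> + norm (decay u N) * \<bar>poly (P (Suc N)) x\<bar>)" for x
      unfolding boundary_def norm_mult using w_pos[of N]
      by (auto intro!: mult_left_mono order_trans[OF norm_triangle_ineq4] simp: norm_mult less_imp_le)
  qed (use integrable_boundary integrable_P in \<open>auto intro!: integrable_norm integrable_abs\<close>)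
  also have "\<dots> = w N * (norm (decay u (Suc N)) * (LINT x|\<mu>. \<bar>poly (P N) x\<bar>)
      + norm (decay u N) * (LINT x|\<mu>. \<bar>poly (P (Suc N)) x\<bar>))"
    by (simp add: integrable_P)
  also have "\<dots> \<le> w N * (norm (decay u (Suc N)) * 1 + norm (decay u N) * 1)"
    using w_pos[of N] by (intro mult_left_mono add_mono integral_abs_P_le) auto
  finally show ?thesis by simp
qed

lemma integral_norm_boundary_tendsto_0: "(\<lambda>N. LINT x|\<mu>. norm (boundary u N x)) \<longlonglongrightarrow> 0"
proof (rule Lim_null_comparison)
  show "\<forall>\<^sub>F N in sequentially. norm (LINT x|\<mu>. norm (boundary u N x)) \<le> w N * (norm (decay u (Suc N)) + norm (decay u N))"
    using integral_norm_boundary_le by (intro always_eventually) (simp add: integral_nonneg_AE)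
  have "(\<lambda>N. w N * (norm (decay u (Suc N)) + norm (decay u N))) \<longlonglongrightarrow> 0 * (norm (0::complex) + norm (0::complex))"
    by (intro tendsto_intros w_tendsto_0 decay_tendsto_0 LIMSEQ_Suc[OF decay_tendsto_0])
  then show "(\<lambda>N. w N * (norm (decay u (Suc N)) + norm (decay u N))) \<longlonglongrightarrow> 0" by simp
qed

lemma boundary_sq:
  "has_bochner_integral \<mu> (\<lambda>x. (norm (boundary u N x))\<^sup>2) ((w N)\<^sup>2 * ((norm (decay u (Suc N)))\<^sup>2 + (norm (decay u N))\<^sup>2))"
proof -
  \<comment> \<open>The boundary term is a combination of \<open>P N\<close> and
    \<open>P (Suc N)\<close> with the decay coefficients interchanged, so Pythagoras
    applies.\<close>
  have "has_bochner_integral \<mu>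
    (\<lambda>x. (w N)\<^sup>2 * (norm (\<Sum>n\<in>{N, Suc N}. (if n = N then decay u (Suc N) else - decay u N) * of_real (poly (P n) x)))\<^sup>2)
    ((w N)\<^sup>2 * (\<Sum>n\<in>{N, Suc N}. (norm (if n = N then decay u (Suc N) else - decay u N))\<^sup>2))"
    by (intro has_bochner_integral_mult_right orth_sum) auto
  then show ?thesis by (simp add: boundary_def norm_mult power_mult_distrib)
qed

lemma boundary_sq_tendsto_0:
  "(\<lambda>N. LINT x|\<mu>. (norm (boundary u N x))\<^sup>2) \<longlonglongrightarrow> 0"
proof -
  have "(\<lambda>N. (w N)\<^sup>2 * ((norm (decay u (Suc N)))\<^sup>2 + (norm (decay u N))\<^sup>2)) \<longlonglongrightarrow> 0\<^sup>2 * ((norm (0::complex))\<^sup>2 + (norm (0::complex))\<^sup>2)"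
    by (intro tendsto_intros w_tendsto_0 decay_tendsto_0 LIMSEQ_Suc[OF decay_tendsto_0])
  then show ?thesis
    using boundary_sq by (simp add: has_bochner_integral_iff)
qed

section \<open>Mass near the reciprocal of u\<close>

text \<open>On \<open>A\<close> the Green identity bounds \<open>norm (jacobi_H lam w 0 u)\<close>
  by \<open>\<delta>\<close> times the partial sum plus the boundary term. Squaring, integrating and
  letting \<open>N\<close> grow removes the boundary term.\<close>

lemma measure_near_le:
  assumes u: "u \<noteq> 0" and A: "A \<in> sets borel" "\<And>x. x \<in> A \<Longrightarrow> norm (inverse u - of_real x) \<le> \<delta>"
    and C: "\<And>N. (\<Sum>n<N. (norm (decay u n))\<^sup>2) \<le> C" and "\<delta> > 0"
  shows "(norm (jacobi_H lam w 0 u))\<^sup>2 * measure \<mu> A \<le> 2 * \<delta>\<^sup>2 * C"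
proof -
  let ?h = "norm (jacobi_H lam w 0 u)"
  have ptw: "?h\<^sup>2 * indicat_real A x \<le> 2 * \<delta>\<^sup>2 * (norm (decay_sum u N x))\<^sup>2 + 2 * (norm (boundary u N x))\<^sup>2" for x N
  proof (cases "x \<in> A")
    case True
    have "jacobi_H lam w 0 u = (inverse u - of_real x) * decay_sum u N x - boundary u N x"
      using decay_sum_eq[OF u, of x N] by simp
    then have "?h \<le> norm (inverse u - of_real x) * norm (decay_sum u N x) + norm (boundary u N x)"
      by (metis norm_mult norm_triangle_ineq4)
    also have "\<dots> \<le> \<delta> * norm (decay_sum u N x) + norm (boundary u N x)"
      using A(2)[OF True] by (intro add_mono mult_right_mono) auto
    finally have "?h\<^sup>2 \<le> (\<delta> * norm (decay_sum u N x) + norm (boundary u N x))\<^sup>2"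
      by (intro power_mono) auto
    also have "\<dots> \<le> 2 * (\<delta> * norm (decay_sum u N x))\<^sup>2 + 2 * (norm (boundary u N x))\<^sup>2"
      using zero_le_power2[of "\<delta> * norm (decay_sum u N x) - norm (boundary u N x)"]
      unfolding power2_diff power2_sum by linarith
    finally show ?thesis using True by (simp add: power_mult_distrib)
  qed auto
  have le: "?h\<^sup>2 * measure \<mu> A \<le> 2 * \<delta>\<^sup>2 * C + 2 * (LINT x|\<mu>. (norm (boundary u N x))\<^sup>2)" for N
  proof -
    have rint: "integrable \<mu> (\<lambda>x. (norm (boundary u N x))\<^sup>2)"
      using boundary_sq by (auto simp: has_bochner_integral_iff)
    have "?h\<^sup>2 * measure \<mu> A = (LINT x|\<mu>. ?h\<^sup>2 * indicat_real A x)"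
      using A by simp
    also have "\<dots> \<le> (LINT x|\<mu>. 2 * \<delta>\<^sup>2 * (norm (decay_sum u N x))\<^sup>2 + 2 * (norm (boundary u N x))\<^sup>2)"
      using A rint integrable_norm_sq_decay_sum[of u N] ptw by (intro integral_mono) (auto simp: emeasure_eq_measure)
    also have "\<dots> = 2 * \<delta>\<^sup>2 * (\<Sum>n<Suc N. (norm (decay u n))\<^sup>2) + 2 * (LINT x|\<mu>. (norm (boundary u N x))\<^sup>2)"
      using rint integrable_norm_sq_decay_sum[of u N] by (simp add: integral_norm_sq_decay_sum)
    also have "\<dots> \<le> 2 * \<delta>\<^sup>2 * C + 2 * (LINT x|\<mu>. (norm (boundary u N x))\<^sup>2)"
      by (intro add_mono mult_left_mono C) auto
    finally show ?thesis .
  qed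
  have "(\<lambda>N. 2 * \<delta>\<^sup>2 * C + 2 * (LINT x|\<mu>. (norm (boundary u N x))\<^sup>2)) \<longlonglongrightarrow> 2 * \<delta>\<^sup>2 * C + 2 * 0"
    by (intro tendsto_intros boundary_sq_tendsto_0)
  then have "(\<lambda>N. 2 * \<delta>\<^sup>2 * C + 2 * (LINT x|\<mu>. (norm (boundary u N x))\<^sup>2)) \<longlonglongrightarrow> 2 * \<delta>\<^sup>2 * C" by simp
  then show ?thesis by (rule LIMSEQ_le_const) (use le in auto)
qed

text \<open>Two consecutive zeros would propagate upwards, as \<open>u\<close> and all
  \<open>w n\<close> are nonzero, and contradict the limit 1.\<close>

lemma decay_0_nonzero:
  assumes "jacobi_H lam w 0 u = 0"
  shows "decay u 0 \<noteq> 0"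
proof
  have u: "u \<noteq> 0" using assms jacobi_H_0 by auto
  assume "decay u 0 = 0"
  then have 1: "jacobi_H lam w (Suc 0) u = 0" using u by (simp add: decay_0)
  have "jacobi_H lam w n u = 0 \<and> jacobi_H lam w (Suc n) u = 0" for n
  proof (induction n)
    case (Suc n)
    then have "0 = (1 - u * complex_of_real (lam n)) * 0
        - u\<^sup>2 * (complex_of_real (w n))\<^sup>2 * jacobi_H lam w (Suc (Suc n)) u"
      using jacobi_H_rec[of n u] by (elim conjE) (simp only:)
    then show ?case using Suc u w_pos[of n] by simp
  qed (use assms 1 in simp)
  then have "(\<lambda>n. jacobi_H lam w n u) \<longlonglongrightarrow> 0" by simp
  then show False using LIMSEQ_unique[OF jacobi_H_tendsto_1] by fastforce
qed

text \<open>The partial sums have fixed nonzero integral and bounded square integral, while at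
  distance at least \<open>\<delta>\<close> from \<open>inverse u\<close> they are dominated by the
  vanishing boundary term. Hence mass stays near \<open>inverse u\<close>, with a bound independent
  of \<open>\<delta>\<close>.\<close>

lemma measure_near_zero_ge:
  assumes H: "jacobi_H lam w 0 u = 0"
  shows "\<exists>c>0. \<forall>\<delta>>0. measure \<mu> {x. norm (inverse u - of_real x) < \<delta>} \<ge> c"
proof -
  have u: "u \<noteq> 0" using H jacobi_H_0 by auto
  obtain C where "C > 0" "\<forall>v N. norm v \<le> norm u \<longrightarrow> (\<Sum>n<N. (norm (decay v n))\<^sup>2) \<le> C"
    using sum_norm_decay_bounded by blast
  then have C: "C > 0" "\<And>N. (\<Sum>n<N. (norm (decay u n))\<^sup>2) \<le> C" by auto
  let ?decay = "norm (decay u 0)"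
  have f0: "?decay > 0" using decay_0_nonzero[OF H] by simp
  have "(?decay)\<^sup>2 / C \<le> measure \<mu> {x. norm (inverse u - of_real x) < \<delta>}" if \<delta>: "\<delta> > 0" for \<delta>
  proof -
    define A where "A = {x::real. norm (inverse u - of_real x) < \<delta>}"
    have "open A" unfolding A_def by (intro open_Collect_less continuous_intros)
    then have A: "A \<in> sets borel" by simp
    \<comment> \<open>The weight in \<open>t <= s * t^2 + 1 / (4 * s)\<close>, chosen so that
      \<open>s * C\<close> is half of \<open>norm (decay u 0)\<close>.\<close>
    define s where "s = ?decay / (2 * C)"
    have s: "s > 0" using f0 C by (simp add: s_def)
    have ptw: "norm (decay_sum u N x) \<le> s * (norm (decay_sum u N x))\<^sup>2 + indicat_real A x / (4 * s) + norm (boundary u N x) / \<delta>" for N x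
    proof (cases "x \<in> A")
      case True
      have "0 \<le> (2 * s * norm (decay_sum u N x) - 1)\<^sup>2 / (4 * s)" using s by simp
      also have "\<dots> = s * (norm (decay_sum u N x))\<^sup>2 + 1 / (4 * s) - norm (decay_sum u N x)"
        using s by (simp add: field_simps power2_eq_square)
      finally show ?thesis using True \<delta> by (simp add: add_increasing2)
    next
      case False
      have "\<delta> * norm (decay_sum u N x) \<le> norm (inverse u - of_real x) * norm (decay_sum u N x)"
        using False by (intro mult_right_mono) (auto simp: A_def)
      also have "\<dots> = norm (boundary u N x)"
        using decay_sum_eq[OF u, of x N] H by (simp flip: norm_mult)
      finally have "norm (decay_sum u N x) \<le> norm (boundary u N x) / \<delta>" using \<delta> by (simp add: field_simps)
      then show ?thesis using s False by (simp add: add_increasing)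
    qed
    have le: "?decay \<le> s * C + measure \<mu> A / (4 * s) + (LINT x|\<mu>. norm (boundary u N x)) / \<delta>" for N
    proof -
      have "?decay \<le> (LINT x|\<mu>. norm (decay_sum u N x))"
        using integral_norm_bound[of \<mu> "decay_sum u N"] by (simp add: integral_decay_sum)
      also have "\<dots> \<le> (LINT x|\<mu>. s * (norm (decay_sum u N x))\<^sup>2 + indicat_real A x / (4 * s) + norm (boundary u N x) / \<delta>)"
        using A integrable_norm_sq_decay_sum[of u N] integrable_boundary[of u N] integrable_decay_sum[of u N] ptw
        by (intro integral_mono) (auto simp: emeasure_eq_measure)
      also have "\<dots> = s * (\<Sum>n<Suc N. (norm (decay u n))\<^sup>2) + measure \<mu> A / (4 * s) + (LINT x|\<mu>. norm (boundary u N x)) / \<delta>"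
        using A integrable_norm_sq_decay_sum[of u N] integrable_boundary[of u N]
        by (simp add: integral_norm_sq_decay_sum emeasure_eq_measure)
      also have "\<dots> \<le> s * C + measure \<mu> A / (4 * s) + (LINT x|\<mu>. norm (boundary u N x)) / \<delta>"
        using s by (intro add_mono mult_left_mono C) auto
      finally show ?thesis .
    qed
    have "(\<lambda>N. s * C + measure \<mu> A / (4 * s) + (LINT x|\<mu>. norm (boundary u N x)) / \<delta>)
        \<longlonglongrightarrow> s * C + measure \<mu> A / (4 * s) + 0 / \<delta>"
      by (intro tendsto_intros integral_norm_boundary_tendsto_0) (use \<delta> in auto)
    then have "?decay \<le> s * C + measure \<mu> A / (4 * s) + 0 / \<delta>"
      by (rule LIMSEQ_le_const) (use le in auto)
    then have "?decay \<le> ?decay / 2 + measure \<mu> A * C / (2 * ?decay)"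
      using f0 C by (simp add: s_def field_simps)
    then have "?decay\<^sup>2 \<le> measure \<mu> A * C"
      using f0 by (simp add: field_simps power2_eq_square)
    then show ?thesis using C(1) by (simp add: A_def field_simps)
  qed
  moreover have "?decay\<^sup>2 / C > 0" using f0 C by simp
  ultimately show ?thesis by blast
qed

section \<open>Stieltjes transform and point masses\<close>

text \<open>The Green identity is divided by \<open>z - x\<close>, whose norm is at least
  \<open>|Im z|\<close>, and integrated; the boundary term vanishes in the limit.\<close>

lemma decay_0_eq_stieltjes:
  assumes "Im z \<noteq> 0"
  shows "decay (inverse z) 0 = jacobi_H lam w 0 (inverse z) * (LINT x|\<mu>. 1 / (z - of_real x))"
proof -
  define u where "u = inverse z"
  have z: "z \<noteq> 0" using assms by auto
  have u: "u \<noteq> 0" "inverse u = z" using z by (auto simp: u_def)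
  have Im_le: "\<bar>Im z\<bar> \<le> norm (z - of_real x)" for x
    using abs_Im_le_cmod[of "z - of_real x"] by simp
  have nz: "z - of_real x \<noteq> 0" for x using Im_le[of x] assms by auto
  have int1: "integrable \<mu> (\<lambda>x. 1 / (z - of_real x))"
  proof (rule integrable_const_bound)
    show "AE x in \<mu>. norm (1 / (z - of_real x)) \<le> 1 / \<bar>Im z\<bar>"
      using Im_le assms by (auto simp: norm_divide intro!: AE_I2 frac_le)
  qed measurable
  let ?h = "jacobi_H lam w 0 u"
  have le: "norm (decay u 0 - ?h * (LINT x|\<mu>. 1 / (z - of_real x))) \<le> (LINT x|\<mu>. norm (boundary u N x)) / \<bar>Im z\<bar>" for N
  proof -
    have "decay u 0 - ?h * (LINT x|\<mu>. 1 / (z - of_real x)) = (LINT x|\<mu>. decay_sum u N x - ?h * (1 / (z - of_real x)))"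
      unfolding Bochner_Integration.integral_diff[OF integrable_decay_sum integrable_mult_right[OF int1]]
        integral_decay_sum integral_mult_right_zero ..
    also have "norm \<dots> \<le> (LINT x|\<mu>. norm (decay_sum u N x - ?h * (1 / (z - of_real x))))"
      by (rule integral_norm_bound)
    also have "\<dots> \<le> (LINT x|\<mu>. norm (boundary u N x) / \<bar>Im z\<bar>)"
    proof (rule integral_mono)
      show "integrable \<mu> (\<lambda>x. norm (decay_sum u N x - ?h * (1 / (z - of_real x))))"
        by (intro integrable_norm Bochner_Integration.integrable_diff integrable_decay_sum integrable_mult_right int1)
      show "integrable \<mu> (\<lambda>x. norm (boundary u N x) / \<bar>Im z\<bar>)"
        by (intro integrable_divide integrable_norm integrable_boundary)
      fix x
      have "decay_sum u N x - ?h * (1 / (z - of_real x)) = boundary u N x / (z - of_real x)"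
      proof -
        have "decay_sum u N x = (?h + boundary u N x) / (z - of_real x)"
          using decay_sum_eq[OF u(1), of x N, unfolded u(2)] nz[of x] by (simp add: eq_divide_eq mult.commute)
        then show ?thesis by (simp add: add_divide_distrib)
      qed
      then show "norm (decay_sum u N x - ?h * (1 / (z - of_real x))) \<le> norm (boundary u N x) / \<bar>Im z\<bar>"
        using Im_le[of x] assms by (simp add: norm_divide frac_le)
    qed
    finally show ?thesis by simp
  qed
  have "(\<lambda>N. (LINT x|\<mu>. norm (boundary u N x)) / \<bar>Im z\<bar>) \<longlonglongrightarrow> 0 / \<bar>Im z\<bar>"
    by (intro tendsto_intros integral_norm_boundary_tendsto_0) (use assms in auto)
  then have "norm (decay u 0 - ?h * (LINT x|\<mu>. 1 / (z - of_real x))) \<le> 0 / \<bar>Im z\<bar>"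
    by (rule LIMSEQ_le_const) (use le in auto)
  then show ?thesis by (simp add: u_def)
qed

text \<open>With \<open>t = 1 / (k + 1)\<close> the integrand is
  \<open>\<i> t / (a - x + \<i> t)\<close>: it is 1 at \<open>x = a\<close>, tends to 0 elsewhere
  and has norm at most 1, so dominated convergence applies.\<close>

lemma jump_limit:
  "(\<lambda>k. LINT x|\<mu>. (\<i> / of_nat (Suc k)) / (of_real a + \<i> / of_nat (Suc k) - of_real x))
     \<longlonglongrightarrow> of_real (measure \<mu> {a})"
proof -
  define s where "s = (\<lambda>k x. (\<i> / of_nat (Suc k)) / (complex_of_real a + \<i> / of_nat (Suc k) - of_real x))"
  have "(\<lambda>k. LINT x|\<mu>. s k x) \<longlonglongrightarrow> (LINT x|\<mu>. of_real (indicat_real {a} x))"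
  proof (rule integral_dominated_convergence)
    show "AE x in \<mu>. (\<lambda>k. s k x) \<longlonglongrightarrow> complex_of_real (indicat_real {a} x)"
    proof (rule AE_I2)
      fix x
      have i0: "(\<lambda>k. \<i> / of_nat (Suc k)) \<longlonglongrightarrow> 0"
        by (rule LIMSEQ_Suc[OF lim_const_over_n])
      show "(\<lambda>k. s k x) \<longlonglongrightarrow> complex_of_real (indicat_real {a} x)"
      proof (cases "x = a")
        case True
        then show ?thesis by (simp add: s_def del: of_nat_Suc)
      next
        case False
        have "(\<lambda>k. s k x) \<longlonglongrightarrow> 0 / (of_real a + 0 - of_real x)"
          unfolding s_def by (intro tendsto_intros i0) (use False in auto)
        then show ?thesis using False by simp
      qed
    qed
    show "AE x in \<mu>. norm (s k x) \<le> 1" for k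
    proof (rule AE_I2)
      fix x
      have "1 / real (Suc k) = \<bar>Im (complex_of_real a + \<i> / of_nat (Suc k) - of_real x)\<bar>"
        by simp
      also have "\<dots> \<le> norm (complex_of_real a + \<i> / of_nat (Suc k) - of_real x)"
        by (rule abs_Im_le_cmod)
      finally have le: "norm (\<i> / of_nat (Suc k)) \<le> norm (complex_of_real a + \<i> / of_nat (Suc k) - of_real x)"
        by (simp add: norm_divide del: of_nat_Suc)
      then show "norm (s k x) \<le> 1"
        unfolding s_def norm_divide[of "\<i> / of_nat (Suc k)"] by (intro divide_le_eq_1[THEN iffD2]) auto
    qed
  qed (auto simp: s_def)
  then show ?thesis by (simp add: s_def emeasure_eq_measure)
qed

text \<open>Along \<open>z k\<close> the Stieltjes identity factors into a difference quotient of
  \<open>jacobi_H lam w 0 (inverse z)\<close> at its zero and an integral tending to the point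
  mass.\<close>

lemma measure_singleton_eq:
  assumes H: "jacobi_H lam w 0 (inverse (complex_of_real a)) = 0"
  shows "of_real (measure \<mu> {a}) = - of_real a * jacobi_H lam w 1 (inverse (of_real a))
    / deriv (jacobi_H lam w 0) (inverse (of_real a))"
proof -
  define u where "u = inverse (complex_of_real a)"
  have u: "u \<noteq> 0" using H jacobi_H_0[of 0] by (auto simp: u_def)
  then have a: "a \<noteq> 0" by (auto simp: u_def)
  define z where "z = (\<lambda>k. complex_of_real a + \<i> / of_nat (Suc k))"
  define H' where "H' = deriv (jacobi_H lam w 0) u"
  have i0: "(\<lambda>k. \<i> / of_nat (Suc k)) \<longlonglongrightarrow> 0"
    by (rule LIMSEQ_Suc[OF lim_const_over_n])
  have z_lim: "z \<longlonglongrightarrow> of_real a"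
    unfolding z_def using tendsto_add[OF tendsto_const i0, of "complex_of_real a"] by simp
  have z_ne: "z k \<noteq> of_real a" for k by (simp add: z_def del: of_nat_Suc)
  have z_Im: "Im (z k) \<noteq> 0" for k by (simp add: z_def del: of_nat_Suc)
  have "(jacobi_H lam w 0 has_field_derivative H') (at u)"
    unfolding H'_def using holomorphic_derivI[OF holomorphic_jacobi_H] by auto
  \<comment> \<open>The inner derivative of \<open>inverse\<close> at \<open>a\<close> is the source
    of the factor \<open>- u^2\<close>.\<close>
  then have "((\<lambda>z. jacobi_H lam w 0 (inverse z)) has_field_derivative H' * (- (inverse (of_real a) ^ Suc (Suc 0)))) (at (of_real a))"
    unfolding u_def using a by (intro DERIV_chain2 DERIV_inverse) auto
  then have "((\<lambda>y. jacobi_H lam w 0 (inverse y) / (y - of_real a)) \<longlongrightarrow> - H' * u\<^sup>2) (at (of_real a))"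
    using H by (simp add: has_field_derivative_iff u_def power2_eq_square)
  moreover have "filterlim z (at (of_real a)) sequentially"
    using z_lim z_ne by (intro filterlim_atI) auto
  ultimately have lim1: "(\<lambda>k. jacobi_H lam w 0 (inverse (z k)) / (z k - of_real a)) \<longlonglongrightarrow> - H' * u\<^sup>2"
    by (rule filterlim_compose)
  have "(\<lambda>k. jacobi_H lam w 0 (inverse (z k)) / (z k - of_real a) *
      (LINT x|\<mu>. (\<i> / of_nat (Suc k)) / (z k - of_real x)))
      \<longlonglongrightarrow> - H' * u\<^sup>2 * of_real (measure \<mu> {a})"
    using tendsto_mult[OF lim1 jump_limit[of a]] unfolding z_def .
  moreover have "jacobi_H lam w 0 (inverse (z k)) / (z k - of_real a) *
      (LINT x|\<mu>. (\<i> / of_nat (Suc k)) / (z k - of_real x)) = decay (inverse (z k)) 0" for k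
  proof -
    have "(LINT x|\<mu>. (\<i> / of_nat (Suc k)) / (z k - of_real x))
        = (LINT x|\<mu>. (\<i> / of_nat (Suc k)) * (1 / (z k - of_real x)))" by simp
    also have "\<dots> = (z k - of_real a) * (LINT x|\<mu>. 1 / (z k - of_real x))"
      unfolding integral_mult_right_zero by (simp add: z_def)
    finally show ?thesis
      using decay_0_eq_stieltjes[OF z_Im[of k]] z_ne[of k] by simp
  qed
  ultimately have "(\<lambda>k. decay (inverse (z k)) 0) \<longlonglongrightarrow> - H' * u\<^sup>2 * of_real (measure \<mu> {a})"
    by simp
  moreover have "(\<lambda>k. decay (inverse (z k)) 0) \<longlonglongrightarrow> decay u 0"
  proof -
    have cont: "isCont (jacobi_H lam w 1) u"
      using holomorphic_on_imp_continuous_on[OF holomorphic_jacobi_H]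
      by (simp add: continuous_on_eq_continuous_at)
    have inv: "(\<lambda>k. inverse (z k)) \<longlonglongrightarrow> u"
      unfolding u_def using a by (intro tendsto_inverse z_lim) auto
    show ?thesis
      unfolding decay_0 by (intro tendsto_mult inv isCont_tendsto_compose[OF cont])
  qed
  ultimately have eq: "- H' * u\<^sup>2 * of_real (measure \<mu> {a}) = decay u 0"
    by (rule LIMSEQ_unique)
  moreover have "decay u 0 \<noteq> 0" using decay_0_nonzero H by (simp add: u_def)
  \<comment> \<open>The zero is simple: a vanishing \<open>H'\<close> would force
    \<open>decay u 0 = 0\<close>. The quotient in the conclusion is therefore genuine.\<close>
  ultimately have "H' \<noteq> 0" by auto
  from eq have "u * (- H' * u * of_real (measure \<mu> {a})) = u * jacobi_H lam w 1 u"
    by (simp add: decay_0 power2_eq_square algebra_simps)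
  then have "- H' * u * of_real (measure \<mu> {a}) = jacobi_H lam w 1 u"
    unfolding mult_left_cancel[OF u] .
  then have "- H' * of_real (measure \<mu> {a}) = of_real a * jacobi_H lam w 1 u"
    using a by (simp add: u_def field_simps)
  then have "of_real (measure \<mu> {a}) * H' = - (of_real a * jacobi_H lam w 1 u)"
    by (metis minus_mult_left minus_minus mult.commute)
  then show ?thesis
    using \<open>H' \<noteq> 0\<close> unfolding H'_def u_def mult_minus_left
    by (subst nonzero_eq_divide_eq)
qed

section \<open>Support and zeros\<close>

lemma zero_in_support:
  assumes H: "jacobi_H lam w 0 u = 0"
  obtains x where "x \<in> measure_support \<mu> - {0}" "inverse u = of_real x"
proof -
  have u: "u \<noteq> 0" using H jacobi_H_0[of 0] by auto
  obtain c where c: "c > 0" "\<And>\<delta>. \<delta> > 0 \<Longrightarrow> measure \<mu> {x. norm (inverse u - of_real x) < \<delta>} \<ge> c"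
    using measure_near_zero_ge[OF H] by blast
  have Im: "Im (inverse u) = 0"
  proof (rule ccontr)
    assume Im: "Im (inverse u) \<noteq> 0"
    \<comment> \<open>No real point is closer to \<open>inverse u\<close> than this, so the set of
      mass at least \<open>c\<close> would be empty.\<close>
    define \<delta> where "\<delta> = \<bar>Im (inverse u)\<bar>"
    have "\<delta> > 0" using Im unfolding \<delta>_def by linarith
    have "\<delta> \<le> norm (inverse u - of_real x)" for x
      unfolding \<delta>_def using abs_Im_le_cmod[of "inverse u - of_real x"] by simp
    then have "{x::real. norm (inverse u - of_real x) < \<delta>} = {}"
      by (auto simp: not_less)
    then show False using c(2)[OF \<open>\<delta> > 0\<close>] c(1) by simp
  qed
  define x where "x = Re (inverse u)"
  have x: "inverse u = of_real x" using Im by (simp add: x_def complex_eq_iff)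
  have "x \<noteq> 0" using x u by auto
  moreover have "x \<in> measure_support \<mu>"
    unfolding measure_support_def
  proof (intro CollectI allI impI)
    fix U assume U: "open U \<and> x \<in> U"
    then obtain \<delta> where \<delta>: "\<delta> > 0" "ball x \<delta> \<subseteq> U" by (meson openE)
    have "{y. norm (inverse u - of_real y) < \<delta>} = ball x \<delta>"
      unfolding x of_real_diff[symmetric] norm_of_real by (auto simp: dist_real_def)
    then have "c \<le> measure \<mu> (ball x \<delta>)" using c(2)[OF \<delta>(1)] by simp
    also have "\<dots> \<le> measure \<mu> U"
      using U \<delta> by (intro finite_measure_mono) auto
    finally show "emeasure \<mu> U > 0" using c by (simp add: emeasure_eq_measure)
  qed
  ultimately show ?thesis using that x by blast
qed

text \<open>Where \<open>jacobi_H lam w 0\<close> is bounded away from 0,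
  \<open>measure_near_le\<close> gives the quadratic bound. The condition
  \<open>|y| > |x| / 2\<close> keeps the reciprocals in one disc, so one \<open>C\<close> serves all
  centres near \<open>x\<close>.\<close>

lemma support_imp_zero:
  assumes x: "x \<in> measure_support \<mu>" "x \<noteq> 0"
  shows "jacobi_H lam w 0 (inverse (of_real x)) = 0"
proof (rule ccontr)
  let ?g = "\<lambda>y::real. jacobi_H lam w 0 (inverse (of_real y))"
  assume nz: "?g x \<noteq> 0"
  define c where "c = norm (?g x) / 2"
  have c: "c > 0" "norm (?g x) > c" using nz by (auto simp: c_def)
  have cont: "isCont (jacobi_H lam w 0) u" for u
    using holomorphic_on_imp_continuous_on[OF holomorphic_jacobi_H]
    by (simp add: continuous_on_eq_continuous_at)
  have "((\<lambda>y::real. inverse (complex_of_real y)) \<longlongrightarrow> inverse (of_real x)) (nhds x)"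
    using x by (intro tendsto_inverse tendsto_of_real filterlim_ident) auto
  then have "((\<lambda>y. norm (?g y)) \<longlongrightarrow> norm (?g x)) (nhds x)"
    by (intro tendsto_norm isCont_tendsto_compose[OF cont])
  then have "\<forall>\<^sub>F y in nhds x. norm (?g y) > c"
    using c(2) by (rule order_tendstoD(1))
  moreover have "\<forall>\<^sub>F y in nhds x. \<bar>y\<bar> > \<bar>x\<bar> / 2"
    using x by (intro order_tendstoD(1)[of _ "\<bar>x\<bar>"] tendsto_rabs filterlim_ident) auto
  ultimately have "\<forall>\<^sub>F y in nhds x. norm (?g y) > c \<and> \<bar>y\<bar> > \<bar>x\<bar> / 2"
    by (rule eventually_conj)
  then obtain \<eta> where \<eta>: "\<eta> > 0" "\<And>y. dist y x < \<eta> \<Longrightarrow> norm (?g y) > c \<and> \<bar>y\<bar> > \<bar>x\<bar> / 2"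
    by (auto simp: eventually_nhds_metric)
  obtain C where C: "C > 0" "\<forall>u N. norm u \<le> 2 / \<bar>x\<bar> \<longrightarrow> (\<Sum>n<N. (norm (decay u n))\<^sup>2) \<le> C"
    using sum_norm_decay_bounded by blast
  have "x \<notin> measure_support \<mu>"
  proof (rule not_in_measure_supportI[OF \<eta>(1)])
    fix z \<delta> :: real assume z: "\<bar>z - x\<bar> < \<eta>" and \<delta>: "\<delta> > 0"
    have gz: "norm (?g z) > c" "\<bar>z\<bar> > \<bar>x\<bar> / 2" using \<eta>(2)[of z] z by (auto simp: dist_real_def)
    define u where "u = inverse (complex_of_real z)"
    have u: "u \<noteq> 0" "inverse u = of_real z" using gz x by (auto simp: u_def)
    have "norm u \<le> 2 / \<bar>x\<bar>"
      using gz(2) x(2) unfolding u_def norm_inverse norm_of_real by (auto simp: field_simps)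
    then have C': "(\<Sum>n<N. (norm (decay u n))\<^sup>2) \<le> C" for N using C by blast
    have "(norm (?g z))\<^sup>2 * measure \<mu> {z - \<delta>..z + \<delta>} \<le> 2 * \<delta>\<^sup>2 * C"
      unfolding u_def[symmetric]
    proof (rule measure_near_le[OF u(1) _ _ C' \<delta>])
      show "norm (inverse u - of_real y) \<le> \<delta>" if "y \<in> {z - \<delta>..z + \<delta>}" for y
        unfolding u of_real_diff[symmetric] norm_of_real using that by auto
    qed auto
    moreover have "c\<^sup>2 * measure \<mu> {z - \<delta>..z + \<delta>} \<le> (norm (?g z))\<^sup>2 * measure \<mu> {z - \<delta>..z + \<delta>}"
      using gz c by (intro mult_right_mono power_mono) auto
    ultimately have "c\<^sup>2 * measure \<mu> {z - \<delta>..z + \<delta>} \<le> 2 * \<delta>\<^sup>2 * C" by linarith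
    then show "measure \<mu> {z - \<delta>..z + \<delta>} \<le> 2 * C / c\<^sup>2 * \<delta>\<^sup>2"
      using c by (simp add: field_simps)
  qed
  with x show False by simp
qed

text \<open>
  A polynomial with prescribed zeros has a nonzero component along \<open>P\<close> at its own degree, so the
  support of the measure cannot be finite.
\<close>

lemma orth_linear_factors:
  assumes "finite A"
  shows "has_bochner_integral \<mu> (\<lambda>x. (\<Prod>s\<in>A. x - s) * poly (P m) x) (LINT x|\<mu>. (\<Prod>s\<in>A. x - s) * poly (P m) x)
    \<and> (m \<ge> card A \<longrightarrow> (LINT x|\<mu>. (\<Prod>s\<in>A. x - s) * poly (P m) x) = (if m = card A then wprod m else 0))"
  using assms
proof (induction A arbitrary: m)
  case empty
  show ?case using integrable_P[of m] integral_P[of m] by (simp add: has_bochner_integral_iff wprod_def)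
next
  case (insert s A)
  define q where "q = (\<lambda>x. \<Prod>s\<in>A. x - s)"
  define I where "I = (\<lambda>m. LINT x|\<mu>. q x * poly (P m) x)"
  have hb: "has_bochner_integral \<mu> (\<lambda>x. q x * poly (P m) x) (I m)" for m
    using insert.IH[of m] by (simp add: q_def I_def)
  have I: "I m = (if m = card A then wprod m else 0)" if "m \<ge> card A" for m
    using insert.IH[of m] that by (simp add: q_def I_def)
  show ?case
  proof (cases m)
    case 0
    have "has_bochner_integral \<mu>
        (\<lambda>x. (lam 0 - s) * (q x * poly (P 0) x) + w 0 * (q x * poly (P (Suc 0)) x))
        ((lam 0 - s) * I 0 + w 0 * I (Suc 0))"
      by (intro has_bochner_integral_add has_bochner_integral_mult_right hb)
    also have "(\<lambda>x. (lam 0 - s) * (q x * poly (P 0) x) + w 0 * (q x * poly (P (Suc 0)) x))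
        = (\<lambda>x. (\<Prod>s\<in>insert s A. x - s) * poly (P m) x)"
    proof
      fix x
      have "(lam 0 - s) * (q x * poly (P 0) x) + w 0 * (q x * poly (P (Suc 0)) x)
          = q x * ((lam 0 - s) + w 0 * poly (P (Suc 0)) x)" by (simp add: P_0 algebra_simps)
      also have "\<dots> = q x * (x - s)" unfolding P_1 by simp
      finally show "(lam 0 - s) * (q x * poly (P 0) x) + w 0 * (q x * poly (P (Suc 0)) x)
        = (\<Prod>s\<in>insert s A. x - s) * poly (P m) x" using insert 0 by (simp add: q_def P_0)
    qed
    finally show ?thesis using insert 0 by (simp add: has_bochner_integral_iff)
  next
    case (Suc n)
    have hb': "has_bochner_integral \<mu>
        (\<lambda>x. w n * (q x * poly (P n) x) + (lam (Suc n) - s) * (q x * poly (P (Suc n)) x)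
          + w (Suc n) * (q x * poly (P (Suc (Suc n))) x))
        (w n * I n + (lam (Suc n) - s) * I (Suc n) + w (Suc n) * I (Suc (Suc n)))"
      by (intro has_bochner_integral_add has_bochner_integral_mult_right hb)
    have "(\<lambda>x. w n * (q x * poly (P n) x) + (lam (Suc n) - s) * (q x * poly (P (Suc n)) x)
          + w (Suc n) * (q x * poly (P (Suc (Suc n))) x))
        = (\<lambda>x. (\<Prod>s\<in>insert s A. x - s) * poly (P m) x)"
    proof
      fix x
      have "w n * (q x * poly (P n) x) + (lam (Suc n) - s) * (q x * poly (P (Suc n)) x)
          + w (Suc n) * (q x * poly (P (Suc (Suc n))) x)
        = q x * (x * poly (P (Suc n)) x - s * poly (P (Suc n)) x)"
        unfolding P_rec[of x n] by (simp add: algebra_simps)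
      then show "w n * (q x * poly (P n) x) + (lam (Suc n) - s) * (q x * poly (P (Suc n)) x)
          + w (Suc n) * (q x * poly (P (Suc (Suc n))) x) = (\<Prod>s\<in>insert s A. x - s) * poly (P m) x"
        using insert Suc by (simp add: q_def algebra_simps)
    qed
    note * = hb'[unfolded this]
    \<comment> \<open>Here \<open>n >= card A\<close>, so the integrals at \<open>Suc n\<close> and
      \<open>Suc (Suc n)\<close> vanish and only \<open>w n * I n\<close> can contribute.\<close>
    have "w n * I n + (lam (Suc n) - s) * I (Suc n) + w (Suc n) * I (Suc (Suc n))
        = (if m = card (insert s A) then wprod m else 0)" if "m \<ge> card (insert s A)"
      using that insert Suc I[of n] I[of "Suc n"] I[of "Suc (Suc n)"] by (auto simp: wprod_Suc)
    with * show ?thesis by (auto simp: has_bochner_integral_iff)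
  qed
qed

lemma infinite_measure_support: "infinite (measure_support \<mu>)"
proof
  assume fin: "finite (measure_support \<mu>)"
  let ?A = "measure_support \<mu>" and ?k = "card (measure_support \<mu>)"
  \<comment> \<open>The product vanishes on the whole support, hence almost everywhere, whereas
    orthogonality gives the value \<open>wprod ?k > 0\<close>.\<close>
  have "(LINT x|\<mu>. (\<Prod>s\<in>?A. x - s) * poly (P ?k) x) = (LINT x|\<mu>. 0)"
    using orth_linear_factors[OF fin, of ?k]
  proof (intro integral_cong_AE)
    show "AE x in \<mu>. (\<Prod>s\<in>?A. x - s) * poly (P ?k) x = 0"
      using AE_in_measure_support by eventually_elim (use fin in \<open>auto intro: prod_zero\<close>)
  qed (auto simp: has_bochner_integral_iff)
  moreover have "(LINT x|\<mu>. (\<Prod>s\<in>?A. x - s) * poly (P ?k) x) = wprod ?k"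
    using orth_linear_factors[OF fin, of ?k] by simp
  ultimately show False using wprod_pos[of ?k] by simp
qed

lemma support_eq_zeros:
  "complex_of_real ` (measure_support \<mu> - {0}) = {inverse z | z. jacobi_H lam w 0 z = 0}"
proof (intro equalityI subsetI)
  fix y assume "y \<in> complex_of_real ` (measure_support \<mu> - {0})"
  then obtain x where x: "x \<in> measure_support \<mu>" "x \<noteq> 0" "y = of_real x" by auto
  then show "y \<in> {inverse z | z. jacobi_H lam w 0 z = 0}"
    using support_imp_zero[OF x(1,2)] by (auto intro!: exI[of _ "inverse (of_real x)"])
next
  fix y assume "y \<in> {inverse z | z. jacobi_H lam w 0 z = 0}"
  then obtain z where z: "y = inverse z" "jacobi_H lam w 0 z = 0" by auto
  from zero_in_support[OF z(2)] obtain x where "x \<in> measure_support \<mu> - {0}" "inverse z = of_real x" .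
  then show "y \<in> complex_of_real ` (measure_support \<mu> - {0})" using z by auto
qed

end

section \<open>Topology of the set of reciprocal zeros\<close>

context jacobi
begin

text \<open>The value 1 at the origin keeps zeros away from a disc around it.\<close>

lemma bounded_inverse_zeros: "bounded {inverse z | z. jacobi_H lam w 0 z = 0}"
proof -
  have "isCont (jacobi_H lam w 0) 0"
    using holomorphic_on_imp_continuous_on[OF holomorphic_jacobi_H]
    by (simp add: continuous_on_eq_continuous_at)
  then have "\<exists>e>0. \<forall>z. dist 0 z < e \<longrightarrow> jacobi_H lam w 0 z \<noteq> 0"
    by (rule continuous_at_avoid) (simp add: jacobi_H_0)
  then obtain e where e: "e > 0" "\<And>z. dist 0 z < e \<Longrightarrow> jacobi_H lam w 0 z \<noteq> 0" by auto
  have "norm (inverse z) \<le> inverse e" if "jacobi_H lam w 0 z = 0" for z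
  proof -
    have "norm z \<ge> e" using e(2)[of z] that by (cases "norm z < e") auto
    then show ?thesis using e(1) unfolding norm_inverse by (rule le_imp_inverse_le)
  qed
  then show ?thesis by (auto intro!: boundedI)
qed

text \<open>An entire function with value 1 at 0 has isolated zeros, and inversion carries this to
  every nonzero point.\<close>

lemma not_islimpt_inverse_zeros:
  assumes "a \<noteq> 0"
  shows "\<not> a islimpt {inverse z | z. jacobi_H lam w 0 z = 0}"
proof -
  have "\<forall>\<^sub>F z in at (inverse a). jacobi_H lam w 0 z \<noteq> 0"
  proof -
    have "\<forall>\<^sub>F z in at (inverse a). jacobi_H lam w 0 z \<noteq> 0 \<and> z \<in> UNIV"
      by (rule non_zero_neighbour_alt[OF holomorphic_jacobi_H, of _ 0]) (auto simp: jacobi_H_0)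
    then show ?thesis by simp
  qed
  moreover have "filterlim inverse (at (inverse a)) (at a)"
    using assms by (intro filterlim_atI tendsto_inverse tendsto_ident_at)
      (auto simp: eventually_at_filter)
  ultimately have "\<forall>\<^sub>F y in at a. jacobi_H lam w 0 (inverse y) \<noteq> 0"
    by (rule eventually_compose_filterlim)
  then show ?thesis
    unfolding islimpt_iff_eventually by (auto elim!: eventually_mono)
qed

lemma discrete_inverse_zeros: "topological_space_class.discrete {inverse z | z. jacobi_H lam w 0 z = 0}"
proof (rule discreteI)
  fix y assume y: "y \<in> {inverse z | z. jacobi_H lam w 0 z = 0}"
  then have "y \<noteq> 0" using jacobi_H_0[of 0] by auto
  then show "y isolated_in {inverse z | z. jacobi_H lam w 0 z = 0}"
    using y not_islimpt_inverse_zeros[of y] by (simp add: isolated_in_islimpt_iff)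
qed

end

theorem proposition3:
  fixes lam w :: "nat \<Rightarrow> real"
    and P :: "nat \<Rightarrow> real poly"
    and \<mu> :: "real measure"
  assumes lam_l1: "summable (\<lambda>n. \<bar>lam n\<bar>)"
    and w_pos: "\<And>n. w n > 0"
    and w_l2: "summable (\<lambda>n. (w n)\<^sup>2)"
    and P_0: "\<And>x. poly (P 0) x = 1"
    and P_1: "\<And>x. poly (P 1) x = (x - lam 0) / w 0"
    and P_rec: "\<And>n x. n \<ge> 1 \<Longrightarrow>
      x * poly (P n) x =
        w (n - 1) * poly (P (n - 1)) x + lam n * poly (P n) x + w n * poly (P (n + 1)) x"
    and orth: "orthogonality_measure P \<mu>"
  shows "complex_of_real ` (measure_support \<mu> - {0}) = {inverse z | z. jacobi_G lam w z = 0}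
    \<and> {inverse z | z. jacobi_G lam w z = 0} \<subseteq> \<real>
    \<and> bounded {inverse z | z. jacobi_G lam w z = 0}
    \<and> topological_space_class.discrete {inverse z | z. jacobi_G lam w z = 0}
    \<and> {a. a islimpt {inverse z | z. jacobi_G lam w z = 0}} = {0}
    \<and> (\<forall>x \<in> measure_support \<mu> - {0}.
      complex_of_real (cdf \<mu> x - Lim (at_left x) (cdf \<mu>)) =
        - complex_of_real x
          * jacobi_G (\<lambda>n. lam (n + 1)) (\<lambda>n. w (n + 1)) (inverse (complex_of_real x))
          / deriv (jacobi_G lam w) (inverse (complex_of_real x)))"
proof -
  interpret real_distribution \<mu> using orth by (simp add: orthogonality_measure_def)
  interpret jacobi_orthogonality lam w \<mu> P
  proof unfold_locales
    show "x * poly (P (Suc n)) x =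
        w n * poly (P n) x + lam (Suc n) * poly (P (Suc n)) x + w (Suc n) * poly (P (Suc (Suc n))) x" for n x
      using P_rec[of "Suc n" x] by simp
    show "w 0 * poly (P (Suc 0)) x = x - lam 0" for x
      using P_1[of x] w_pos[of 0] by simp
    show "has_bochner_integral \<mu> (\<lambda>x. poly (P m) x * poly (P n) x) (if m = n then 1 else 0)" for m n
      using orth by (simp add: orthogonality_measure_def)
  qed (use lam_l1 w_pos w_l2 P_0 in auto)
  define T where "T = {inverse z | z. jacobi_H lam w 0 z = 0}"
  have G: "jacobi_G lam w = jacobi_H lam w 0" by (rule ext) (rule jacobi_G_eq)
  have T: "complex_of_real ` (measure_support \<mu> - {0}) = T"
    unfolding T_def by (rule support_eq_zeros)
  have inf: "infinite T"
    unfolding T[symmetric] using infinite_measure_support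
    by (subst finite_image_iff) (auto simp: inj_on_def)
  have bdd: "bounded T" unfolding T_def by (rule bounded_inverse_zeros)
  \<comment> \<open>By Bolzano-Weierstrass the infinite bounded set has a limit point; nonzero
    points are excluded, so it is 0.\<close>
  obtain a where "a islimpt T"
    by (rule bounded_infinite_imp_islimpt[OF subset_refl bdd inf])
  moreover have "b = 0" if "b islimpt T" for b
    using not_islimpt_inverse_zeros[of b] that unfolding T_def[symmetric] by blast
  ultimately have limpt: "{a. a islimpt T} = {0}" by blast
  have jump: "complex_of_real (cdf \<mu> x - Lim (at_left x) (cdf \<mu>)) =
        - complex_of_real x
          * jacobi_G (\<lambda>n. lam (n + 1)) (\<lambda>n. w (n + 1)) (inverse (complex_of_real x))
          / deriv (jacobi_G lam w) (inverse (complex_of_real x))"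
    if "x \<in> measure_support \<mu> - {0}" for x
    unfolding G jacobi_G_shift_eq cdf_jump
    by (rule measure_singleton_eq[OF support_imp_zero]) (use that in auto)
  show ?thesis
    unfolding G T_def[symmetric]
  proof (intro conjI ballI)
    show "T \<subseteq> \<real>" unfolding T[symmetric] by auto
    show "topological_space_class.discrete T" unfolding T_def by (rule discrete_inverse_zeros)
  qed (use T limpt bdd jump[unfolded G] in simp_all)
qed

end
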